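(* Let $\mathcal{D}$ be a triangulated category and let $[\mathbf{t}_1,\mathbf{t}_2]$ be a normal interval in $\mathsf{stors}\,\mathcal{D}$. Then $\mathcal{H}_{[\mathbf{t}_1,\mathbf{t}_2]}$ is a quasi-abelian category.
   Context: Let $\mathcal{D}$ be a triangulated category with shift automorphism $\Sigma$; put $\mathbb{E}^{-1}(X,Y)=\mathrm{Hom}_{\mathcal{D}}(X,\Sigma^{-1}Y)$. An $s$-torsion pair in $\mathcal{D}$ is a pair $(\mathcal{T},\mathcal{F})$ of full isomorphism-closed subcategories such that $\mathrm{Hom}_{\mathcal{D}}(\mathcal{T},\mathcal{F})=0$, $\mathbb{E}^{-1}(\mathcal{T},\mathcal{F})=0$, and every $D\in\mathcal{D}$ admits a distinguished triangle $T\to D\to F\to\Sigma T$ with $T\in\mathcal{T}$, $F\in\mathcal{F}$. $\mathsf{stors}\,\mathcal{D}$ is the poset of $s$-torsion pairs, with $(\mathcal{T},\mathcal{F})\le(\mathcal{T}',\mathcal{F}')$ iff $\mathcal{T}\subseteq\mathcal{T}'$. For $\mathbf{t}_1=(\mathcal{T}_1,\mathcal{F}_1)\le\mathbf{t}_2=(\mathcal{T}_2,\mathcal{F}_2)$, the interval is $[\mathbf{t}_1,\mathbf{t}_2]=\{\mathbf{t}:\mathbf{t}_1\le\mathbf{t}\le\mathbf{t}_2\}$ and its heart is the full subcategory $\mathcal{H}_{[\mathbf{t}_1,\mathbf{t}_2]}=\mathcal{F}_1\cap\mathcal{T}_2$. The interval $[\mathbf{t}_1,\mathbf{t}_2]$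 is normal if $\mathbb{E}^{-1}(\mathcal{T}_2,\mathcal{F}_1)=0$. A quasi-abelian category is an additive category in which every morphism has a kernel and a cokernel, every push-out of a kernel is a kernel, and every pull-back of a cokernel is a cokernel. *)

theory Defs
  imports "HOL-Algebra.Group"
begin

section \<open>Categories\<close>

record ('o, 'm) category_data =
  Obj :: "'o set"
  Arr :: "'m set"
  Dom :: "'m \<Rightarrow> 'o"
  Cod :: "'m \<Rightarrow> 'o"
  Ident :: "'o \<Rightarrow> 'm" ("\<iota>\<index>")
  Comp :: "'m \<Rightarrow> 'm \<Rightarrow> 'm" (infixl "\<cdot>\<index>" 70)

definition Hom :: "('o, 'm, 'x) category_data_scheme \<Rightarrow> 'o \<Rightarrow> 'o \<Rightarrow> 'm set" where
  "Hom C X Y = {f \<in> Arr C. Dom C f = X \<and> Cod C f = Y}"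

locale category =
  fixes C :: "('o, 'm, 'x) category_data_scheme" (structure)
  assumes Dom_Obj: "f \<in> Arr C \<Longrightarrow> Dom C f \<in> Obj C"
    and Cod_Obj: "f \<in> Arr C \<Longrightarrow> Cod C f \<in> Obj C"
    and Ident_Hom: "X \<in> Obj C \<Longrightarrow> \<iota> X \<in> Hom C X X"
    and Comp_Hom: "\<lbrakk>f \<in> Hom C X Y; g \<in> Hom C Y Z\<rbrakk> \<Longrightarrow> g \<cdot> f \<in> Hom C X Z"
    and Comp_assoc:
      "\<lbrakk>f \<in> Hom C W X; g \<in> Hom C X Y; h \<in> Hom C Y Z\<rbrakk> \<Longrightarrow> h \<cdot> g \<cdot> f = h \<cdot> (g \<cdot> f)"
    and Comp_Ident_right: "f \<in> Hom C X Y \<Longrightarrow> f \<cdot> \<iota> X = f"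
    and Comp_Ident_left: "f \<in> Hom C X Y \<Longrightarrow> \<iota> Y \<cdot> f = f"

definition is_iso :: "('o, 'm, 'x) category_data_scheme \<Rightarrow> 'm \<Rightarrow> 'o \<Rightarrow> 'o \<Rightarrow> bool" where
  "is_iso C f X Y \<longleftrightarrow> f \<in> Hom C X Y \<and>
     (\<exists>g \<in> Hom C Y X. g \<cdot>\<^bsub>C\<^esub> f = \<iota>\<^bsub>C\<^esub> X \<and> f \<cdot>\<^bsub>C\<^esub> g = \<iota>\<^bsub>C\<^esub> Y)"

definition isomorphic :: "('o, 'm, 'x) category_data_scheme \<Rightarrow> 'o \<Rightarrow> 'o \<Rightarrow> bool" where
  "isomorphic C X Y \<longleftrightarrow> (\<exists>f. is_iso C f X Y)"

definition is_zero_object :: "('o, 'm, 'x) category_data_scheme \<Rightarrow> 'o \<Rightarrow> bool" where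
  "is_zero_object C Z \<longleftrightarrow> Z \<in> Obj C \<and>
     (\<forall>X \<in> Obj C. (\<exists>!f. f \<in> Hom C X Z) \<and> (\<exists>!f. f \<in> Hom C Z X))"

text \<open>
  The square with sides \<open>f : X \<rightarrow> Y\<close>, \<open>g : X \<rightarrow> X'\<close>, \<open>f' : X' \<rightarrow> P\<close>, \<open>g' : Y \<rightarrow> P\<close> is a push-out,
  so that \<open>f'\<close> is the push-out of \<open>f\<close> along \<open>g\<close>.
\<close>

definition is_pushout ::
  "('o, 'm, 'x) category_data_scheme \<Rightarrow> 'm \<Rightarrow> 'm \<Rightarrow> 'm \<Rightarrow> 'm \<Rightarrow> bool" where
  "is_pushout C f g f' g' \<longleftrightarrow>
     (\<exists>X Y X' P. f \<in> Hom C X Y \<and> g \<in> Hom C X X' \<and> f' \<in> Hom C X' P \<and> g' \<in> Hom C Y P \<and>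
        f' \<cdot>\<^bsub>C\<^esub> g = g' \<cdot>\<^bsub>C\<^esub> f \<and>
        (\<forall>Q \<in> Obj C. \<forall>a \<in> Hom C X' Q. \<forall>b \<in> Hom C Y Q. a \<cdot>\<^bsub>C\<^esub> g = b \<cdot>\<^bsub>C\<^esub> f \<longrightarrow>
           (\<exists>!u. u \<in> Hom C P Q \<and> u \<cdot>\<^bsub>C\<^esub> f' = a \<and> u \<cdot>\<^bsub>C\<^esub> g' = b)))"

text \<open>
  The square with sides \<open>f : X \<rightarrow> Y\<close>, \<open>g : Y' \<rightarrow> Y\<close>, \<open>f' : P \<rightarrow> Y'\<close>, \<open>g' : P \<rightarrow> X\<close> is a pull-back,
  so that \<open>f'\<close> is the pull-back of \<open>f\<close> along \<open>g\<close>.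
\<close>

definition is_pullback ::
  "('o, 'm, 'x) category_data_scheme \<Rightarrow> 'm \<Rightarrow> 'm \<Rightarrow> 'm \<Rightarrow> 'm \<Rightarrow> bool" where
  "is_pullback C f g f' g' \<longleftrightarrow>
     (\<exists>X Y Y' P. f \<in> Hom C X Y \<and> g \<in> Hom C Y' Y \<and> f' \<in> Hom C P Y' \<and> g' \<in> Hom C P X \<and>
        g \<cdot>\<^bsub>C\<^esub> f' = f \<cdot>\<^bsub>C\<^esub> g' \<and>
        (\<forall>Q \<in> Obj C. \<forall>a \<in> Hom C Q Y'. \<forall>b \<in> Hom C Q X. g \<cdot>\<^bsub>C\<^esub> a = f \<cdot>\<^bsub>C\<^esub> b \<longrightarrow>
           (\<exists>!u. u \<in> Hom C Q P \<and> f' \<cdot>\<^bsub>C\<^esub> u = a \<and> g' \<cdot>\<^bsub>C\<^esub> u = b)))"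


section \<open>Additive and quasi-abelian categories\<close>

text \<open>\<open>Add\<close> is only meaningful on pairs of parallel morphisms.\<close>

record ('o, 'm) preadditive_data = "('o, 'm) category_data" +
  Add :: "'m \<Rightarrow> 'm \<Rightarrow> 'm" (infixl "\<boxplus>\<index>" 65)
  Zero :: "'o \<Rightarrow> 'o \<Rightarrow> 'm" ("\<zero>\<zero>\<index>")

definition Hom_group :: "('o, 'm, 'x) preadditive_data_scheme \<Rightarrow> 'o \<Rightarrow> 'o \<Rightarrow> 'm monoid" where
  "Hom_group C X Y = \<lparr>carrier = Hom C X Y, mult = Add C, one = Zero C X Y\<rparr>"

definition Neg :: "('o, 'm, 'x) preadditive_data_scheme \<Rightarrow> 'm \<Rightarrow> 'm" where
  "Neg C f = inv\<^bsub>Hom_group C (Dom C f) (Cod C f)\<^esub> f"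

locale preadditive_category = category C
  for C :: "('o, 'm, 'x) preadditive_data_scheme" (structure) +
  assumes Hom_comm_group: "\<lbrakk>X \<in> Obj C; Y \<in> Obj C\<rbrakk> \<Longrightarrow> comm_group (Hom_group C X Y)"
    and Comp_Add_right:
      "\<lbrakk>f \<in> Hom C X Y; f' \<in> Hom C X Y; g \<in> Hom C Y Z\<rbrakk> \<Longrightarrow> g \<cdot> (f \<boxplus> f') = (g \<cdot> f) \<boxplus> (g \<cdot> f')"
    and Comp_Add_left:
      "\<lbrakk>f \<in> Hom C X Y; g \<in> Hom C Y Z; g' \<in> Hom C Y Z\<rbrakk> \<Longrightarrow> (g \<boxplus> g') \<cdot> f = (g \<cdot> f) \<boxplus> (g' \<cdot> f)"

locale additive_category = preadditive_category C
  for C :: "('o, 'm, 'x) preadditive_data_scheme" (structure) +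
  assumes zero_object: "\<exists>Z. is_zero_object C Z"
    and biproduct: "\<lbrakk>X \<in> Obj C; Y \<in> Obj C\<rbrakk> \<Longrightarrow>
      \<exists>P \<in> Obj C. \<exists>i \<in> Hom C X P. \<exists>j \<in> Hom C Y P. \<exists>p \<in> Hom C P X. \<exists>q \<in> Hom C P Y.
        p \<cdot> i = \<iota> X \<and> q \<cdot> j = \<iota> Y \<and> p \<cdot> j = \<zero>\<zero> Y X \<and> q \<cdot> i = \<zero>\<zero> X Y \<and>
        (i \<cdot> p) \<boxplus> (j \<cdot> q) = \<iota> P"

definition is_kernel_of :: "('o, 'm, 'x) preadditive_data_scheme \<Rightarrow> 'm \<Rightarrow> 'm \<Rightarrow> bool" where
  "is_kernel_of C k f \<longleftrightarrow>
     (\<exists>K X Y. k \<in> Hom C K X \<and> f \<in> Hom C X Y \<and> f \<cdot>\<^bsub>C\<^esub> k = Zero C K Y \<and>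
        (\<forall>L \<in> Obj C. \<forall>l \<in> Hom C L X. f \<cdot>\<^bsub>C\<^esub> l = Zero C L Y \<longrightarrow>
           (\<exists>!u. u \<in> Hom C L K \<and> k \<cdot>\<^bsub>C\<^esub> u = l)))"

definition is_cokernel_of :: "('o, 'm, 'x) preadditive_data_scheme \<Rightarrow> 'm \<Rightarrow> 'm \<Rightarrow> bool" where
  "is_cokernel_of C c f \<longleftrightarrow>
     (\<exists>X Y Q. f \<in> Hom C X Y \<and> c \<in> Hom C Y Q \<and> c \<cdot>\<^bsub>C\<^esub> f = Zero C X Q \<and>
        (\<forall>L \<in> Obj C. \<forall>l \<in> Hom C Y L. l \<cdot>\<^bsub>C\<^esub> f = Zero C X L \<longrightarrow>
           (\<exists>!u. u \<in> Hom C Q L \<and> u \<cdot>\<^bsub>C\<^esub> c = l)))"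

definition is_kernel :: "('o, 'm, 'x) preadditive_data_scheme \<Rightarrow> 'm \<Rightarrow> bool" where
  "is_kernel C k \<longleftrightarrow> (\<exists>f \<in> Arr C. is_kernel_of C k f)"

definition is_cokernel :: "('o, 'm, 'x) preadditive_data_scheme \<Rightarrow> 'm \<Rightarrow> bool" where
  "is_cokernel C c \<longleftrightarrow> (\<exists>f \<in> Arr C. is_cokernel_of C c f)"

locale quasi_abelian_category = additive_category C
  for C :: "('o, 'm, 'x) preadditive_data_scheme" (structure) +
  assumes has_kernel: "f \<in> Arr C \<Longrightarrow> \<exists>k. is_kernel_of C k f"
    and has_cokernel: "f \<in> Arr C \<Longrightarrow> \<exists>c. is_cokernel_of C c f"
    and pushout_kernel: "\<lbrakk>is_pushout C f g f' g'; is_kernel C f\<rbrakk> \<Longrightarrow> is_kernel C f'"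
    and pullback_cokernel: "\<lbrakk>is_pullback C f g f' g'; is_cokernel C f\<rbrakk> \<Longrightarrow> is_cokernel C f'"

definition full_subcategory ::
  "('o, 'm, 'x) preadditive_data_scheme \<Rightarrow> 'o set \<Rightarrow> ('o, 'm) preadditive_data" where
  "full_subcategory C S =
     \<lparr>Obj = S \<inter> Obj C, Arr = {f \<in> Arr C. Dom C f \<in> S \<and> Cod C f \<in> S},
      Dom = Dom C, Cod = Cod C, Ident = Ident C, Comp = Comp C, Add = Add C, Zero = Zero C\<rparr>"


section \<open>Triangulated categories\<close>

text \<open>
  The shift \<open>\<Sigma>\<close> is given by its actions \<open>ShO\<close> on objects and \<open>ShA\<close> on morphisms. An element
  \<open>(f, g, h)\<close> of \<open>Dist\<close> is a distinguished triangle \<open>X \<rightarrow> Y \<rightarrow> Z \<rightarrow> \<Sigma>X\<close>.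
\<close>

record ('o, 'm) triangulated_data = "('o, 'm) preadditive_data" +
  ShO :: "'o \<Rightarrow> 'o"
  ShA :: "'m \<Rightarrow> 'm"
  Dist :: "('m \<times> 'm \<times> 'm) set"

definition is_triangle :: "('o, 'm, 'x) triangulated_data_scheme \<Rightarrow>
    'o \<Rightarrow> 'o \<Rightarrow> 'o \<Rightarrow> 'm \<Rightarrow> 'm \<Rightarrow> 'm \<Rightarrow> bool" where
  "is_triangle D X Y Z f g h \<longleftrightarrow> f \<in> Hom D X Y \<and> g \<in> Hom D Y Z \<and> h \<in> Hom D Z (ShO D X)"

definition dist_triangle :: "('o, 'm, 'x) triangulated_data_scheme \<Rightarrow>
    'o \<Rightarrow> 'o \<Rightarrow> 'o \<Rightarrow> 'm \<Rightarrow> 'm \<Rightarrow> 'm \<Rightarrow> bool" where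
  "dist_triangle D X Y Z f g h \<longleftrightarrow> is_triangle D X Y Z f g h \<and> (f, g, h) \<in> Dist D"

locale triangulated_category = additive_category D
  for D :: "('o, 'm, 'x) triangulated_data_scheme" (structure) +
  assumes ShO_bij: "bij_betw (ShO D) (Obj D) (Obj D)"
    and ShA_bij: "bij_betw (ShA D) (Arr D) (Arr D)"
    and ShA_Hom: "f \<in> Hom D X Y \<Longrightarrow> ShA D f \<in> Hom D (ShO D X) (ShO D Y)"
    and ShA_Ident: "X \<in> Obj D \<Longrightarrow> ShA D (\<iota> X) = \<iota> (ShO D X)"
    and ShA_Comp: "\<lbrakk>f \<in> Hom D X Y; g \<in> Hom D Y Z\<rbrakk> \<Longrightarrow> ShA D (g \<cdot> f) = ShA D g \<cdot> ShA D f"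
    and ShA_Add: "\<lbrakk>f \<in> Hom D X Y; g \<in> Hom D X Y\<rbrakk> \<Longrightarrow> ShA D (f \<boxplus> g) = ShA D f \<boxplus> ShA D g"
    and Dist_triangle: "(f, g, h) \<in> Dist D \<Longrightarrow> \<exists>X Y Z. is_triangle D X Y Z f g h"
    and TR1_iso:
      "\<lbrakk>dist_triangle D X Y Z f g h; is_triangle D X' Y' Z' f' g' h';
        is_iso D a X X'; is_iso D b Y Y'; is_iso D c Z Z';
        b \<cdot> f = f' \<cdot> a; c \<cdot> g = g' \<cdot> b; ShA D a \<cdot> h = h' \<cdot> c\<rbrakk>
       \<Longrightarrow> dist_triangle D X' Y' Z' f' g' h'"
    and TR1_Ident:
      "\<lbrakk>X \<in> Obj D; is_zero_object D Z\<rbrakk>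
       \<Longrightarrow> dist_triangle D X X Z (\<iota> X) (\<zero>\<zero> X Z) (\<zero>\<zero> Z (ShO D X))"
    and TR1_cone: "f \<in> Hom D X Y \<Longrightarrow> \<exists>Z g h. dist_triangle D X Y Z f g h"
    and TR2:
      "is_triangle D X Y Z f g h \<Longrightarrow>
       dist_triangle D X Y Z f g h \<longleftrightarrow> dist_triangle D Y Z (ShO D X) g h (Neg D (ShA D f))"
    and TR3:
      "\<lbrakk>dist_triangle D X Y Z f g h; dist_triangle D X' Y' Z' f' g' h';
        a \<in> Hom D X X'; b \<in> Hom D Y Y'; b \<cdot> f = f' \<cdot> a\<rbrakk>
       \<Longrightarrow> \<exists>c \<in> Hom D Z Z'. c \<cdot> g = g' \<cdot> b \<and> ShA D a \<cdot> h = h' \<cdot> c"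
    and TR4:
      "\<lbrakk>dist_triangle D X Y A f f' f''; dist_triangle D Y Z B g g' g'';
        dist_triangle D X Z E (g \<cdot> f) h' h''\<rbrakk>
       \<Longrightarrow> \<exists>u v. dist_triangle D A E B u v (ShA D f' \<cdot> g'') \<and>
             u \<cdot> f' = h' \<cdot> g \<and> h'' \<cdot> u = f'' \<and> v \<cdot> h' = g' \<and> g'' \<cdot> v = ShA D f \<cdot> h''"

definition ShInvO :: "('o, 'm, 'x) triangulated_data_scheme \<Rightarrow> 'o \<Rightarrow> 'o" where
  "ShInvO D = inv_into (Obj D) (ShO D)"

definition Eneg1 :: "('o, 'm, 'x) triangulated_data_scheme \<Rightarrow> 'o \<Rightarrow> 'o \<Rightarrow> 'm set" where
  "Eneg1 D X Y = Hom D X (ShInvO D Y)"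


section \<open>\<open>s\<close>-torsion pairs\<close>

text \<open>Full subcategories of \<open>D\<close> are represented by their sets of objects.\<close>

definition iso_closed :: "('o, 'm, 'x) category_data_scheme \<Rightarrow> 'o set \<Rightarrow> bool" where
  "iso_closed C S \<longleftrightarrow> S \<subseteq> Obj C \<and> (\<forall>X \<in> S. \<forall>Y \<in> Obj C. isomorphic C X Y \<longrightarrow> Y \<in> S)"

definition Hom_vanishes :: "('o, 'm, 'x) preadditive_data_scheme \<Rightarrow> 'o set \<Rightarrow> 'o set \<Rightarrow> bool" where
  "Hom_vanishes D S S' \<longleftrightarrow> (\<forall>X \<in> S. \<forall>Y \<in> S'. Hom D X Y = {Zero D X Y})"

definition Eneg1_vanishes ::
  "('o, 'm, 'x) triangulated_data_scheme \<Rightarrow> 'o set \<Rightarrow> 'o set \<Rightarrow> bool" where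
  "Eneg1_vanishes D S S' \<longleftrightarrow> (\<forall>X \<in> S. \<forall>Y \<in> S'. Eneg1 D X Y = {Zero D X (ShInvO D Y)})"

definition s_torsion_pair ::
  "('o, 'm, 'x) triangulated_data_scheme \<Rightarrow> 'o set \<times> 'o set \<Rightarrow> bool" where
  "s_torsion_pair D = (\<lambda>(\<T>, \<F>).
     iso_closed D \<T> \<and> iso_closed D \<F> \<and>
     Hom_vanishes D \<T> \<F> \<and> Eneg1_vanishes D \<T> \<F> \<and>
     (\<forall>X \<in> Obj D. \<exists>T \<in> \<T>. \<exists>F \<in> \<F>. \<exists>f g h. dist_triangle D T X F f g h))"

definition stors ::
  "('o, 'm, 'x) triangulated_data_scheme \<Rightarrow> ('o set \<times> 'o set) gorder" where
  "stors D = \<lparr>carrier = {t. s_torsion_pair D t}, eq = (=), le = (\<lambda>t t'. fst t \<subseteq> fst t')\<rparr>"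

text \<open>An interval \<open>[t\<^sub>1, t\<^sub>2]\<close> in \<open>stors D\<close> is represented by its endpoints.\<close>

definition is_interval ::
  "('o, 'm, 'x) triangulated_data_scheme \<Rightarrow> 'o set \<times> 'o set \<Rightarrow> 'o set \<times> 'o set \<Rightarrow> bool" where
  "is_interval D t1 t2 \<longleftrightarrow>
     t1 \<in> carrier (stors D) \<and> t2 \<in> carrier (stors D) \<and> t1 \<sqsubseteq>\<^bsub>stors D\<^esub> t2"

definition normal_interval ::
  "('o, 'm, 'x) triangulated_data_scheme \<Rightarrow> 'o set \<times> 'o set \<Rightarrow> 'o set \<times> 'o set \<Rightarrow> bool" where
  "normal_interval D t1 t2 \<longleftrightarrow> is_interval D t1 t2 \<and> Eneg1_vanishes D (fst t2) (snd t1)"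

definition heart :: "('o, 'm, 'x) triangulated_data_scheme \<Rightarrow>
    'o set \<times> 'o set \<Rightarrow> 'o set \<times> 'o set \<Rightarrow> ('o, 'm) preadditive_data" where
  "heart D t1 t2 = full_subcategory D (snd t1 \<inter> fst t2)"

end

(*
  The fibre K of a morphism X -> Y of the heart lies in F1, and its torsion part for (T2, F2) lies in
  the heart and is the kernel; dually for cokernels. Normality makes Hom(\<Sigma>H, H) vanish on the
  heart H, so every distinguished triangle X -> Y -> Z with all three terms in H is a
  kernel-cokernel pair. Conversely, the cone of a kernel and the fibre of a cokernel lie in H, so
  push-outs of kernels and pull-backs of cokernels can be compared with the triangles obtained by
  transporting the connecting morphism.
*)

theory Submission
  imports Defs
begin

section \<open>Preadditive categories\<close>

text \<open>Membership in the heart is always checked by testing: F1 is the right orthogonal of T1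
  and T2 the left orthogonal of F2, so an object lies in the heart once all maps into it from T1 and
  all maps from it to F2 vanish. The condition on \<open>Eneg1\<close> enters as Hom(\<Sigma>X, Y) =
  0. Such groups are the obstruction to cancelling a map of a triangle: k in K -> X -> Y is
  cancellable against L if Hom(\<Sigma>L, Y) = 0. The delicate point is that a kernel in the heart
  is known only through test objects of the heart, while its cone lives in D. It is therefore
  compared with the explicit kernel T -> K -> Y of g : Y -> Z, where K is the fibre of g and F the
  F2-part of K. An octahedron presents the cone of T -> Y as an extension of Z by F, both in F1; the
  proof performs this argument as a chase of maps from T1. For the same reason a push-out in the
  heart can be mapped only to objects of the heart, so the extension that it is compared with has to
  lie there; closure under extensions provides this.\<close>

context category
begin

lemma Hom_Obj: "f \<in> Hom C X Y \<Longrightarrow> X \<in> Obj C" "f \<in> Hom C X Y \<Longrightarrow> Y \<in> Obj C"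
  using Dom_Obj Cod_Obj by (auto simp: Hom_def)

end

context preadditive_category
begin

lemma Zero_Hom: "X \<in> Obj C \<Longrightarrow> Y \<in> Obj C \<Longrightarrow> \<zero>\<zero> X Y \<in> Hom C X Y"
  using comm_group.axioms(2)[OF Hom_comm_group, THEN group.is_monoid, THEN monoid.one_closed]
  by (simp add: Hom_group_def)

lemma Add_Hom:
  assumes "f \<in> Hom C X Y" "g \<in> Hom C X Y"
  shows "f \<boxplus> g \<in> Hom C X Y"
proof -
  interpret G: comm_group "Hom_group C X Y"
    using Hom_comm_group Hom_Obj assms by blast
  show ?thesis
    using G.m_closed assms by (simp add: Hom_group_def)
qed

lemma Add_Zero:
  assumes "f \<in> Hom C X Y"
  shows "f \<boxplus> \<zero>\<zero> X Y = f" "\<zero>\<zero> X Y \<boxplus> f = f"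
proof -
  interpret G: comm_group "Hom_group C X Y"
    using Hom_comm_group Hom_Obj assms by blast
  show "f \<boxplus> \<zero>\<zero> X Y = f" "\<zero>\<zero> X Y \<boxplus> f = f"
    using G.r_one G.l_one assms by (simp_all add: Hom_group_def)
qed

lemma Add_idem_Zero:
  assumes "f \<in> Hom C X Y" "f \<boxplus> f = f"
  shows "f = \<zero>\<zero> X Y"
proof -
  interpret G: comm_group "Hom_group C X Y"
    using Hom_comm_group Hom_Obj assms by blast
  show ?thesis
    using G.r_cancel_one'[of f f] assms by (simp add: Hom_group_def)
qed

lemma Neg_Hom:
  assumes "f \<in> Hom C X Y"
  shows "Neg C f \<in> Hom C X Y"
proof -
  interpret G: comm_group "Hom_group C X Y"
    using Hom_comm_group Hom_Obj assms by blast
  show ?thesis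
    using G.inv_closed[of f] assms by (simp add: Neg_def Hom_group_def Hom_def)
qed

lemma Add_Neg:
  assumes "f \<in> Hom C X Y"
  shows "f \<boxplus> Neg C f = \<zero>\<zero> X Y"
proof -
  interpret G: comm_group "Hom_group C X Y"
    using Hom_comm_group Hom_Obj assms by blast
  show ?thesis
    using G.r_inv[of f] assms by (simp add: Neg_def Hom_group_def Hom_def)
qed

lemma Neg_unique:
  assumes "f \<in> Hom C X Y" "g \<in> Hom C X Y" "f \<boxplus> g = \<zero>\<zero> X Y"
  shows "Neg C f = g" "Neg C g = f"
proof -
  interpret G: comm_group "Hom_group C X Y"
    using Hom_comm_group Hom_Obj assms by blast
  show "Neg C f = g" "Neg C g = f"
    using G.inv_equality[of f g] G.inv_equality[of g f] G.m_comm[of f g] assms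
    by (simp_all add: Neg_def Hom_group_def Hom_def)
qed

lemma Neg_Neg: "f \<in> Hom C X Y \<Longrightarrow> Neg C (Neg C f) = f"
  using Neg_unique(2)[OF _ Neg_Hom Add_Neg] by blast

lemma Neg_Zero: "X \<in> Obj C \<Longrightarrow> Y \<in> Obj C \<Longrightarrow> Neg C (\<zero>\<zero> X Y) = \<zero>\<zero> X Y"
  using Neg_unique(1)[OF Zero_Hom Zero_Hom Add_Zero(1)[OF Zero_Hom]] by blast

lemma eq_iff_Add_Neg_Zero:
  assumes "f \<in> Hom C X Y" "g \<in> Hom C X Y" "f \<boxplus> Neg C g = \<zero>\<zero> X Y"
  shows "f = g"
  using Neg_unique(2)[OF assms(1) Neg_Hom[OF assms(2)] assms(3)] Neg_Neg[OF assms(2)] by simp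

lemma Comp_Zero_right:
  assumes "g \<in> Hom C Y Z" "X \<in> Obj C"
  shows "g \<cdot> \<zero>\<zero> X Y = \<zero>\<zero> X Z"
proof -
  have z: "\<zero>\<zero> X Y \<in> Hom C X Y"
    using Zero_Hom assms Hom_Obj by blast
  show ?thesis
    using Add_idem_Zero[OF Comp_Hom[OF z assms(1)]] Comp_Add_right[OF z z assms(1)] Add_Zero(1)[OF z]
    by simp
qed

lemma Comp_Zero_left:
  assumes "f \<in> Hom C X Y" "Z \<in> Obj C"
  shows "\<zero>\<zero> Y Z \<cdot> f = \<zero>\<zero> X Z"
proof -
  have z: "\<zero>\<zero> Y Z \<in> Hom C Y Z"
    using Zero_Hom assms Hom_Obj by blast
  show ?thesis
    using Add_idem_Zero[OF Comp_Hom[OF assms(1) z]] Comp_Add_left[OF assms(1) z z] Add_Zero(1)[OF z]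
    by simp
qed

lemma Comp_Neg_right:
  assumes "f \<in> Hom C X Y" "g \<in> Hom C Y Z"
  shows "g \<cdot> Neg C f = Neg C (g \<cdot> f)"
  using Neg_unique(1)[OF Comp_Hom[OF assms] Comp_Hom[OF Neg_Hom[OF assms(1)] assms(2)]]
    Comp_Add_right[OF assms(1) Neg_Hom[OF assms(1)] assms(2)] Add_Neg[OF assms(1)]
    Comp_Zero_right[OF assms(2)] Hom_Obj[OF assms(1)] by simp

lemma Comp_Neg_left:
  assumes "f \<in> Hom C X Y" "g \<in> Hom C Y Z"
  shows "Neg C g \<cdot> f = Neg C (g \<cdot> f)"
  using Neg_unique(1)[OF Comp_Hom[OF assms] Comp_Hom[OF assms(1) Neg_Hom[OF assms(2)]]]
    Comp_Add_left[OF assms(1) assms(2) Neg_Hom[OF assms(2)]] Add_Neg[OF assms(2)]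
    Comp_Zero_left[OF assms(1)] Hom_Obj[OF assms(2)] by simp

text \<open>This is the shape of a commuting square between rotated triangles: each side carries the
  sign of its own triangle, and the two signs cancel.\<close>

lemma Comp_Neg_cancel:
  assumes f: "f \<in> Hom C X Y" and g: "g \<in> Hom C Y Z" and f': "f' \<in> Hom C X Y'" and g': "g' \<in> Hom C Y' Z"
    and eq: "g \<cdot> Neg C f = Neg C g' \<cdot> f'"
  shows "g \<cdot> f = g' \<cdot> f'"
proof -
  have "Neg C (Neg C (g \<cdot> f)) = Neg C (Neg C (g' \<cdot> f'))"
    using eq Comp_Neg_right[OF f g] Comp_Neg_left[OF f' g'] by simp
  then show ?thesis
    using Neg_Neg[OF Comp_Hom[OF f g]] Neg_Neg[OF Comp_Hom[OF f' g']] by simp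
qed

text \<open>Subtraction reduces every uniqueness claim for factorisations to the case of zero, which
  is the form that exact sequences deliver.\<close>

lemma mono_if_cancel_Zero:
  assumes "k \<in> Hom C X Y" "u \<in> Hom C L X" "v \<in> Hom C L X" "k \<cdot> u = k \<cdot> v"
    and "\<And>w. w \<in> Hom C L X \<Longrightarrow> k \<cdot> w = \<zero>\<zero> L Y \<Longrightarrow> w = \<zero>\<zero> L X"
  shows "u = v"
proof -
  have "k \<cdot> (u \<boxplus> Neg C v) = \<zero>\<zero> L Y"
    using Comp_Add_right[OF assms(2) Neg_Hom[OF assms(3)] assms(1)] Comp_Neg_right[OF assms(3,1)]
      Add_Neg[OF Comp_Hom[OF assms(3,1)]] assms(4) by simp
  then show ?thesis
    using assms(5) Add_Hom[OF assms(2) Neg_Hom[OF assms(3)]] eq_iff_Add_Neg_Zero[OF assms(2,3)] by blast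
qed

lemma epi_if_cancel_Zero:
  assumes "c \<in> Hom C X Y" "u \<in> Hom C Y L" "v \<in> Hom C Y L" "u \<cdot> c = v \<cdot> c"
    and "\<And>w. w \<in> Hom C Y L \<Longrightarrow> w \<cdot> c = \<zero>\<zero> X L \<Longrightarrow> w = \<zero>\<zero> Y L"
  shows "u = v"
proof -
  have "(u \<boxplus> Neg C v) \<cdot> c = \<zero>\<zero> X L"
    using Comp_Add_left[OF assms(1,2) Neg_Hom[OF assms(3)]] Comp_Neg_left[OF assms(1,3)]
      Add_Neg[OF Comp_Hom[OF assms(1,3)]] assms(4) by simp
  then show ?thesis
    using assms(5) Add_Hom[OF assms(2) Neg_Hom[OF assms(3)]] eq_iff_Add_Neg_Zero[OF assms(2,3)] by blast
qed

end

section \<open>Triangulated categories\<close>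

context triangulated_category
begin

lemma ShO_Obj: "X \<in> Obj D \<Longrightarrow> ShO D X \<in> Obj D"
  using ShO_bij by (auto simp: bij_betw_def)

lemma ShO_surj: "Y \<in> Obj D \<Longrightarrow> \<exists>X \<in> Obj D. ShO D X = Y"
  using ShO_bij by (metis bij_betw_def imageE)

lemma ShA_inj:
  assumes "f \<in> Hom D X Y" "g \<in> Hom D X' Y'" "ShA D f = ShA D g"
  shows "f = g"
  using assms ShA_bij by (auto simp: bij_betw_def Hom_def inj_on_def)

lemma ShA_surj:
  assumes "f \<in> Hom D (ShO D X) (ShO D Y)" "X \<in> Obj D" "Y \<in> Obj D"
  shows "\<exists>g \<in> Hom D X Y. ShA D g = f"
proof -
  obtain g where g: "g \<in> Arr D" "ShA D g = f"
    using assms(1) ShA_bij unfolding Hom_def by (metis (no_types, lifting) bij_betw_def imageE mem_Collect_eq)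
  have g': "g \<in> Hom D (Dom D g) (Cod D g)"
    using g by (simp add: Hom_def)
  have "f \<in> Hom D (ShO D (Dom D g)) (ShO D (Cod D g))"
    using ShA_Hom[OF g'] g by simp
  then have "ShO D (Dom D g) = ShO D X" "ShO D (Cod D g) = ShO D Y"
    using assms(1) by (simp_all add: Hom_def)
  then have "Dom D g = X" "Cod D g = Y"
    using inj_onD[OF bij_betw_imp_inj_on[OF ShO_bij]] assms(2,3) Hom_Obj[OF g'] by blast+
  then show ?thesis
    using g g' by blast
qed

lemma ShA_Zero:
  assumes "X \<in> Obj D" "Y \<in> Obj D"
  shows "ShA D (\<zero>\<zero> X Y) = \<zero>\<zero> (ShO D X) (ShO D Y)"
  using Add_idem_Zero ShA_Hom[OF Zero_Hom[OF assms]] ShA_Add[OF Zero_Hom[OF assms] Zero_Hom[OF assms]]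
    Add_Zero(1)[OF Zero_Hom[OF assms]] by simp

lemma ShA_eq_Zero:
  assumes "f \<in> Hom D X Y" "ShA D f = \<zero>\<zero> (ShO D X) (ShO D Y)"
  shows "f = \<zero>\<zero> X Y"
  using ShA_inj[OF assms(1) Zero_Hom] ShA_Zero assms Hom_Obj by metis

lemma ShA_Neg:
  assumes "f \<in> Hom D X Y"
  shows "ShA D (Neg D f) = Neg D (ShA D f)"
  using Neg_unique(1)[OF ShA_Hom[OF assms] ShA_Hom[OF Neg_Hom[OF assms]]]
    ShA_Add[OF assms Neg_Hom[OF assms]] Add_Neg[OF assms] ShA_Zero Hom_Obj[OF assms] by simp

section \<open>Rotation and completion of triangles\<close>

lemma dist_triangle_Hom:
  assumes "dist_triangle D X Y Z f g h"
  shows "f \<in> Hom D X Y" "g \<in> Hom D Y Z" "h \<in> Hom D Z (ShO D X)"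
  using assms by (auto simp: dist_triangle_def is_triangle_def)

lemma dist_triangle_Obj:
  assumes "dist_triangle D X Y Z f g h"
  shows "X \<in> Obj D" "Y \<in> Obj D" "Z \<in> Obj D"
  using dist_triangle_Hom[OF assms] Hom_Obj by blast+

lemma rotate:
  assumes "dist_triangle D X Y Z f g h"
  shows "dist_triangle D Y Z (ShO D X) g h (Neg D (ShA D f))"
  using assms TR2 by (auto simp: dist_triangle_def)

lemma rotate_back:
  assumes "dist_triangle D Y Z (ShO D X) g h f" "X \<in> Obj D"
  shows "\<exists>f'. dist_triangle D X Y Z f' g h \<and> f = Neg D (ShA D f')"
proof -
  note H = dist_triangle_Hom[OF assms(1)]
  \<comment> \<open>The sign is built into the choice of the preimage: e lifts -f, so that
    -\<Sigma>e is f, as \<open>TR2\<close> demands.\<close>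
  obtain e where e: "e \<in> Hom D X Y" "ShA D e = Neg D f"
    using ShA_surj[OF Neg_Hom[OF H(3)] assms(2)] dist_triangle_Obj[OF assms(1)] by blast
  then have "f = Neg D (ShA D e)"
    using Neg_Neg H(3) by simp
  moreover have "is_triangle D X Y Z e g h"
    using e H by (simp add: is_triangle_def)
  ultimately show ?thesis
    using TR2 assms(1) by metis
qed

lemma fibre_exists:
  assumes "f \<in> Hom D X Y"
  shows "\<exists>K k d. dist_triangle D K X Y k f d"
proof -
  obtain Z g h where t: "dist_triangle D X Y Z f g h"
    using TR1_cone assms by blast
  obtain K where "K \<in> Obj D" "ShO D K = Z"
    using ShO_surj dist_triangle_Obj[OF t] by blast
  then show ?thesis
    using rotate_back t by blast
qed

text \<open>A prescribed connecting morphism h is realised by taking its fibre Y and rotating back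
  once more. This is the source of the comparison objects for push-outs and pull-backs.\<close>

lemma extension_exists:
  assumes "h \<in> Hom D Z (ShO D X)" "X \<in> Obj D"
  shows "\<exists>Y f g. dist_triangle D X Y Z f g h"
proof -
  obtain Y g k where "dist_triangle D Y Z (ShO D X) g h k"
    using fibre_exists assms by blast
  then show ?thesis
    using rotate_back assms by blast
qed

section \<open>Exactness of the Hom functors on triangles\<close>

lemma dist_comp_Zero:
  assumes "dist_triangle D X Y Z f g h"
  shows "g \<cdot> f = \<zero>\<zero> X Z"
proof -
  note H = dist_triangle_Hom[OF assms] and O = dist_triangle_Obj[OF assms]
  obtain N where N: "is_zero_object D N" "N \<in> Obj D"
    using zero_object by (auto simp: is_zero_object_def)
  \<comment> \<open>The identity of X and f map the trivial triangle on X to the given one, so g f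
    factors through the zero object N.\<close>
  obtain c where "c \<in> Hom D N Z" "c \<cdot> \<zero>\<zero> X N = g \<cdot> f"
    using TR3[OF TR1_Ident[OF O(1) N(1)] assms Ident_Hom[OF O(1)] H(1)] by blast
  then show ?thesis
    using Comp_Zero_right O by metis
qed

text \<open>\<open>TR3\<close> supplies only third components, so the trivial triangle on L and the
  given one are rotated until the wanted map L -> X appears, shifted, in third place.\<close>

lemma dist_exact_cov:
  assumes t: "dist_triangle D X Y Z f g h"
    and l: "l \<in> Hom D L Y" "g \<cdot> l = \<zero>\<zero> L Z"
  shows "\<exists>k \<in> Hom D L X. l = f \<cdot> k"
proof -
  note H = dist_triangle_Hom[OF t] and O = dist_triangle_Obj[OF t]
  have L: "L \<in> Obj D"
    using Hom_Obj l by blast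
  obtain N where N: "is_zero_object D N" "N \<in> Obj D"
    using zero_object by (auto simp: is_zero_object_def)
  have z: "\<zero>\<zero> N Z \<cdot> \<zero>\<zero> L N = g \<cdot> l"
    using Comp_Zero_left[OF Zero_Hom] l L N O by simp
  obtain c where c: "c \<in> Hom D (ShO D L) (ShO D X)"
    "ShA D l \<cdot> Neg D (ShA D (\<iota> L)) = Neg D (ShA D f) \<cdot> c"
    using TR3[OF rotate[OF TR1_Ident[OF L N(1)]] rotate[OF t] l(1) Zero_Hom[OF N(2) O(3)] z] by blast
  obtain k where k: "k \<in> Hom D L X" "ShA D k = c"
    using ShA_surj c L O by blast
  have "ShA D l \<cdot> ShA D (\<iota> L) = ShA D f \<cdot> ShA D k"
    using Comp_Neg_cancel[OF ShA_Hom[OF Ident_Hom[OF L]] ShA_Hom[OF l(1)] ShA_Hom[OF k(1)] ShA_Hom[OF H(1)]]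
      c(2) k(2) by simp
  then have "ShA D l = ShA D (f \<cdot> k)"
    using ShA_Comp[OF k(1) H(1)] ShA_Comp[OF Ident_Hom[OF L] l(1)] Comp_Ident_right[OF l(1)] by simp
  then show ?thesis
    using ShA_inj[OF l(1) Comp_Hom[OF k(1) H(1)]] k by blast
qed

lemma dist_exact_contra:
  assumes t: "dist_triangle D X Y Z f g h"
    and l: "l \<in> Hom D Y L" "l \<cdot> f = \<zero>\<zero> X L"
  shows "\<exists>k \<in> Hom D Z L. l = k \<cdot> g"
proof -
  note H = dist_triangle_Hom[OF t] and O = dist_triangle_Obj[OF t]
  have L: "L \<in> Obj D"
    using Hom_Obj l by blast
  obtain N where N: "is_zero_object D N" "N \<in> Obj D"
    using zero_object by (auto simp: is_zero_object_def)
  obtain M where M: "M \<in> Obj D" "ShO D M = N"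
    using ShO_surj N by blast
  \<comment> \<open>The trivial triangle on L is rotated back, so that L is both its second and its
    third term and the map produced by \<open>TR3\<close> is already Z -> L.\<close>
  obtain m where m: "dist_triangle D M L L m (\<iota> L) (\<zero>\<zero> L N)"
    using rotate_back[of L L M] TR1_Ident[OF L N(1)] M by metis
  have z: "l \<cdot> f = m \<cdot> \<zero>\<zero> X M"
    using Comp_Zero_right[OF dist_triangle_Hom(1)[OF m]] l O by simp
  obtain k where "k \<in> Hom D Z L" "k \<cdot> g = \<iota> L \<cdot> l"
    using TR3[OF t m Zero_Hom[OF O(1) M(1)] l(1) z] by blast
  then show ?thesis
    using Comp_Ident_left l by metis
qed

lemma dist_exact_cov_shift:
  assumes t: "dist_triangle D X Y Z f g h"
    and l: "l \<in> Hom D L (ShO D X)" "ShA D f \<cdot> l = \<zero>\<zero> L (ShO D Y)"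
  shows "\<exists>k \<in> Hom D L Z. l = h \<cdot> k"
proof (rule dist_exact_cov[OF rotate[OF rotate[OF t]] l(1)])
  note H = dist_triangle_Hom[OF t] and O = dist_triangle_Obj[OF t]
  show "Neg D (ShA D f) \<cdot> l = \<zero>\<zero> L (ShO D Y)"
    using Comp_Neg_left[OF l(1) ShA_Hom[OF H(1)]] l(2) Neg_Zero[OF Hom_Obj(1)[OF l(1)] ShO_Obj[OF O(2)]]
    by simp
qed

text \<open>The obstruction to extending l along f is its composite with the connecting morphism.
  The sign from rotation is absorbed into the extension: \<Sigma>l = s (-\<Sigma>f) desuspends to l
  = (-k) f.\<close>

lemma dist_exact_contra_shift:
  assumes t: "dist_triangle D X Y Z f g h"
    and l: "l \<in> Hom D X L" "ShA D l \<cdot> h = \<zero>\<zero> Z (ShO D L)"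
  shows "\<exists>k \<in> Hom D Y L. l = k \<cdot> f"
proof -
  note H = dist_triangle_Hom[OF t] and O = dist_triangle_Obj[OF t]
  have L: "L \<in> Obj D"
    using Hom_Obj l by blast
  obtain s where s: "s \<in> Hom D (ShO D Y) (ShO D L)" "ShA D l = s \<cdot> Neg D (ShA D f)"
    using dist_exact_contra[OF rotate[OF rotate[OF t]] ShA_Hom[OF l(1)] l(2)] by blast
  obtain k where k: "k \<in> Hom D Y L" "ShA D k = s"
    using ShA_surj s L O by blast
  have "ShA D l = ShA D (k \<cdot> Neg D f)"
    using s k ShA_Neg[OF H(1)] ShA_Comp[OF Neg_Hom[OF H(1)] k(1)] by simp
  then have "l = k \<cdot> Neg D f"
    using ShA_inj[OF l(1) Comp_Hom[OF Neg_Hom[OF H(1)] k(1)]] by blast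
  also have "\<dots> = Neg D k \<cdot> f"
    using Comp_Neg_left[OF H(1) k(1)] Comp_Neg_right[OF H(1) k(1)] by simp
  finally show ?thesis
    using Neg_Hom k by blast
qed

text \<open>Two rotations move the missing middle component to third place, where \<open>TR3\<close>
  produces it; the result is then desuspended.\<close>

lemma TR3_middle:
  assumes t: "dist_triangle D X Y Z f g h" and t': "dist_triangle D X' Y' Z' f' g' h'"
    and a: "a \<in> Hom D X X'" and c: "c \<in> Hom D Z Z'" and sq: "ShA D a \<cdot> h = h' \<cdot> c"
  shows "\<exists>b \<in> Hom D Y Y'. b \<cdot> f = f' \<cdot> a \<and> c \<cdot> g = g' \<cdot> b"
proof -
  note H = dist_triangle_Hom[OF t] and O = dist_triangle_Obj[OF t]
  note H' = dist_triangle_Hom[OF t'] and O' = dist_triangle_Obj[OF t']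
  obtain s where s: "s \<in> Hom D (ShO D Y) (ShO D Y')"
    "s \<cdot> Neg D (ShA D f) = Neg D (ShA D f') \<cdot> ShA D a"
    "ShA D c \<cdot> Neg D (ShA D g) = Neg D (ShA D g') \<cdot> s"
    using TR3[OF rotate[OF rotate[OF t]] rotate[OF rotate[OF t']] c ShA_Hom[OF a] sq] by blast
  obtain b where b: "b \<in> Hom D Y Y'" "ShA D b = s"
    using ShA_surj s O O' by blast
  have "ShA D (b \<cdot> f) = ShA D (f' \<cdot> a)"
    using Comp_Neg_cancel[OF ShA_Hom[OF H(1)] ShA_Hom[OF b(1)] ShA_Hom[OF a] ShA_Hom[OF H'(1)]]
      s(2) b(2) ShA_Comp[OF H(1) b(1)] ShA_Comp[OF a H'(1)] by simp
  moreover have "ShA D (c \<cdot> g) = ShA D (g' \<cdot> b)"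
    using Comp_Neg_cancel[OF ShA_Hom[OF H(2)] ShA_Hom[OF c] ShA_Hom[OF b(1)] ShA_Hom[OF H'(2)]]
      s(3) b(2) ShA_Comp[OF H(2) c] ShA_Comp[OF b(1) H'(2)] by simp
  ultimately show ?thesis
    using ShA_inj[OF Comp_Hom[OF H(1) b(1)] Comp_Hom[OF a H'(1)]]
      ShA_inj[OF Comp_Hom[OF H(2) c] Comp_Hom[OF b(1) H'(2)]] b(1) by blast
qed

lemma TR3_left:
  assumes t: "dist_triangle D X Y Z f g h" and t': "dist_triangle D X' Y' Z' f' g' h'"
    and b: "b \<in> Hom D Y Y'" and c: "c \<in> Hom D Z Z'" and sq: "c \<cdot> g = g' \<cdot> b"
  shows "\<exists>a \<in> Hom D X X'. ShA D a \<cdot> h = h' \<cdot> c"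
  using TR3[OF rotate[OF t] rotate[OF t'] b c sq] ShA_surj dist_triangle_Obj[OF t]
    dist_triangle_Obj[OF t'] by metis

text \<open>After a shift, a map to K killed by k comes from Hom(\<Sigma>L, Y) through d. Shifting u
  avoids working with the inverse of \<Sigma>.\<close>

lemma fibre_cancel:
  assumes t: "dist_triangle D K X Y k f d"
    and u: "u \<in> Hom D L K" "k \<cdot> u = \<zero>\<zero> L X"
    and van: "\<And>s. s \<in> Hom D (ShO D L) Y \<Longrightarrow> s = \<zero>\<zero> (ShO D L) Y"
  shows "u = \<zero>\<zero> L K"
proof -
  note H = dist_triangle_Hom[OF t] and O = dist_triangle_Obj[OF t]
  have L: "L \<in> Obj D"
    using Hom_Obj u by blast
  have "ShA D k \<cdot> ShA D u = \<zero>\<zero> (ShO D L) (ShO D X)"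
    using ShA_Comp[OF u(1) H(1)] u(2) ShA_Zero L O by simp
  then obtain s where "s \<in> Hom D (ShO D L) Y" "ShA D u = d \<cdot> s"
    using dist_exact_cov_shift[OF t ShA_Hom[OF u(1)]] by blast
  then have "ShA D u = \<zero>\<zero> (ShO D L) (ShO D K)"
    using van Comp_Zero_right[OF H(3) ShO_Obj[OF L]] by metis
  then show ?thesis
    using ShA_eq_Zero u by blast
qed

lemma cofibre_cancel:
  assumes t: "dist_triangle D X Y Z f g h"
    and u: "u \<in> Hom D Z L" "u \<cdot> g = \<zero>\<zero> Y L"
    and van: "\<And>s. s \<in> Hom D (ShO D X) L \<Longrightarrow> s = \<zero>\<zero> (ShO D X) L"
  shows "u = \<zero>\<zero> Z L"
  using dist_exact_contra[OF rotate[OF t] u] van Comp_Zero_left[OF dist_triangle_Hom(3)[OF t]]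
    Hom_Obj[OF u(1)] by metis

section \<open>s-torsion pairs as pairs of orthogonal classes\<close>

lemma Eneg1_vanishes_shift:
  assumes "Eneg1_vanishes D S S'" "X \<in> S" "Y \<in> S'" "X \<in> Obj D" and m: "m \<in> Hom D (ShO D X) Y"
  shows "m = \<zero>\<zero> (ShO D X) Y"
proof -
  define Y' where "Y' = ShInvO D Y"
  have Y: "Y \<in> ShO D ` Obj D"
    using Hom_Obj[OF m] ShO_surj by blast
  \<comment> \<open>\<open>inv_into\<close> is a genuine preimage here because Y lies in the image
    of \<Sigma> on objects.\<close>
  then have Y': "Y' \<in> Obj D" "ShO D Y' = Y"
    unfolding Y'_def ShInvO_def using inv_into_into[OF Y] f_inv_into_f[OF Y] by simp_all
  obtain m' where m': "m' \<in> Hom D X Y'" "ShA D m' = m"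
    using ShA_surj[of m X Y'] m Y' assms(4) by blast
  then have "m' = \<zero>\<zero> X Y'"
    using assms(1-3) by (auto simp: Eneg1_vanishes_def Eneg1_def Y'_def)
  then show ?thesis
    using ShA_Zero[OF assms(4) Y'(1)] m' Y' by simp
qed

lemma s_torsion_pairD:
  assumes "s_torsion_pair D (\<T>, \<F>)"
  shows "\<T> \<subseteq> Obj D" "\<F> \<subseteq> Obj D" "iso_closed D \<T>" "iso_closed D \<F>" "Eneg1_vanishes D \<T> \<F>"
    and "\<lbrakk>X \<in> \<T>; Y \<in> \<F>; f \<in> Hom D X Y\<rbrakk> \<Longrightarrow> f = \<zero>\<zero> X Y"
    and "\<lbrakk>X \<in> \<T>; Y \<in> \<F>; f \<in> Hom D (ShO D X) Y\<rbrakk> \<Longrightarrow> f = \<zero>\<zero> (ShO D X) Y"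
    and "X \<in> Obj D \<Longrightarrow> \<exists>T \<in> \<T>. \<exists>F \<in> \<F>. \<exists>f g h. dist_triangle D T X F f g h"
proof -
  show *: "\<T> \<subseteq> Obj D" "\<F> \<subseteq> Obj D" "iso_closed D \<T>" "iso_closed D \<F>" "Eneg1_vanishes D \<T> \<F>"
    using assms by (auto simp: s_torsion_pair_def iso_closed_def)
  show "f = \<zero>\<zero> X Y" if "X \<in> \<T>" "Y \<in> \<F>" "f \<in> Hom D X Y"
    using assms that by (auto simp: s_torsion_pair_def Hom_vanishes_def)
  show "f = \<zero>\<zero> (ShO D X) Y" if "X \<in> \<T>" "Y \<in> \<F>" "f \<in> Hom D (ShO D X) Y"
    using Eneg1_vanishes_shift * that by blast
  show "\<exists>T \<in> \<T>. \<exists>F \<in> \<F>. \<exists>f g h. dist_triangle D T X F f g h" if "X \<in> Obj D"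
    using assms that by (auto simp: s_torsion_pair_def)
qed

text \<open>The first map of the triangle of X is zero, so g : X -> F is split mono. Its complement
  in F would be \<Sigma>T; the vanishing of Hom(\<Sigma>T, F) excludes this and makes g an
  isomorphism.\<close>

lemma torsion_free_if_orthogonal:
  assumes s: "s_torsion_pair D (\<T>, \<F>)" and X: "X \<in> Obj D"
    and van: "\<And>S t. S \<in> \<T> \<Longrightarrow> t \<in> Hom D S X \<Longrightarrow> t = \<zero>\<zero> S X"
  shows "X \<in> \<F>"
proof -
  obtain T F f g h where TF: "T \<in> \<T>" "F \<in> \<F>" and t: "dist_triangle D T X F f g h"
    using s_torsion_pairD(8)[OF s X] by blast
  note H = dist_triangle_Hom[OF t] and O = dist_triangle_Obj[OF t]
  have "f = \<zero>\<zero> T X"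
    using van TF H by blast
  then have "\<iota> X \<cdot> f = \<zero>\<zero> T X"
    using Comp_Ident_left H by blast
  then obtain k where k: "k \<in> Hom D F X" "\<iota> X = k \<cdot> g"
    using dist_exact_contra[OF t Ident_Hom[OF X]] by blast
  \<comment> \<open>So far k is only a left inverse of g. Equality of g k with the identity is
    tested after g, which is cancellable since Hom(\<Sigma>T, F) = 0.\<close>
  have "(g \<cdot> k) \<cdot> g = \<iota> F \<cdot> g"
    using Comp_assoc[OF H(2) k(1) H(2)] k(2) Comp_Ident_right[OF H(2)] Comp_Ident_left[OF H(2)]
    by simp
  then have "g \<cdot> k = \<iota> F"
    by (rule epi_if_cancel_Zero[OF H(2) Comp_Hom[OF k(1) H(2)] Ident_Hom[OF O(3)]
          _ cofibre_cancel[OF t _ _ s_torsion_pairD(7)[OF s TF]]])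
  then have "is_iso D k F X"
    using k H by (auto simp: is_iso_def)
  then show ?thesis
    using s_torsion_pairD(4)[OF s] TF X unfolding iso_closed_def isomorphic_def by blast
qed

text \<open>Dually, f : T -> X becomes split epi, and Hom(\<Sigma>T, F) = 0 makes it cancellable on
  the left.\<close>

lemma torsion_if_orthogonal:
  assumes s: "s_torsion_pair D (\<T>, \<F>)" and X: "X \<in> Obj D"
    and van: "\<And>S t. S \<in> \<F> \<Longrightarrow> t \<in> Hom D X S \<Longrightarrow> t = \<zero>\<zero> X S"
  shows "X \<in> \<T>"
proof -
  obtain T F f g h where TF: "T \<in> \<T>" "F \<in> \<F>" and t: "dist_triangle D T X F f g h"
    using s_torsion_pairD(8)[OF s X] by blast
  note H = dist_triangle_Hom[OF t] and O = dist_triangle_Obj[OF t]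
  have "g = \<zero>\<zero> X F"
    using van TF H by blast
  then have "g \<cdot> \<iota> X = \<zero>\<zero> X F"
    using Comp_Ident_right H by blast
  then obtain k where k: "k \<in> Hom D X T" "\<iota> X = f \<cdot> k"
    using dist_exact_cov[OF t Ident_Hom[OF X]] by blast
  have "f \<cdot> (k \<cdot> f) = f \<cdot> \<iota> T"
    using Comp_assoc[OF H(1) k(1) H(1)] k(2) Comp_Ident_right[OF H(1)] Comp_Ident_left[OF H(1)]
    by simp
  then have "k \<cdot> f = \<iota> T"
    by (rule mono_if_cancel_Zero[OF H(1) Comp_Hom[OF H(1) k(1)] Ident_Hom[OF O(1)]
          _ fibre_cancel[OF t _ _ s_torsion_pairD(7)[OF s TF]]])
  then have "is_iso D f T X"
    using k H by (auto simp: is_iso_def)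
  then show ?thesis
    using s_torsion_pairD(3)[OF s] TF X unfolding iso_closed_def isomorphic_def by blast
qed

end

section \<open>Full subcategories\<close>

lemma full_subcategory_simps:
  "Obj (full_subcategory C S) = S \<inter> Obj C"
  "Arr (full_subcategory C S) = {f \<in> Arr C. Dom C f \<in> S \<and> Cod C f \<in> S}"
  "Dom (full_subcategory C S) = Dom C"
  "Cod (full_subcategory C S) = Cod C"
  "Ident (full_subcategory C S) = Ident C"
  "Comp (full_subcategory C S) = Comp C"
  "Add (full_subcategory C S) = Add C"
  "Zero (full_subcategory C S) = Zero C"
  by (simp_all add: full_subcategory_def)

lemma Hom_full_subcategory:
  "Hom (full_subcategory C S) X Y = (if X \<in> S \<and> Y \<in> S then Hom C X Y else {})"
  by (auto simp: Hom_def full_subcategory_simps)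

context preadditive_category
begin

lemma is_kernel_of_full_subcategoryI:
  assumes "k \<in> Hom C K X" "f \<in> Hom C X Y" "f \<cdot> k = \<zero>\<zero> K Y" "K \<in> S" "X \<in> S" "Y \<in> S"
    and "\<And>L l. \<lbrakk>L \<in> S; l \<in> Hom C L X; f \<cdot> l = \<zero>\<zero> L Y\<rbrakk> \<Longrightarrow> \<exists>u. u \<in> Hom C L K \<and> k \<cdot> u = l"
    and "\<And>L u. \<lbrakk>L \<in> S; u \<in> Hom C L K; k \<cdot> u = \<zero>\<zero> L X\<rbrakk> \<Longrightarrow> u = \<zero>\<zero> L K"
  shows "is_kernel_of (full_subcategory C S) k f"
proof -
  have "\<exists>!u. u \<in> Hom C L K \<and> k \<cdot> u = l" if "L \<in> S" "l \<in> Hom C L X" "f \<cdot> l = \<zero>\<zero> L Y" for L l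
    using assms(7)[OF that] mono_if_cancel_Zero[OF assms(1)] assms(8)[OF that(1)] by metis
  then show ?thesis
    unfolding is_kernel_of_def Hom_full_subcategory full_subcategory_simps
    using assms(1-6) by (intro exI[of _ K] exI[of _ X] exI[of _ Y]) simp
qed

lemma is_cokernel_of_full_subcategoryI:
  assumes "f \<in> Hom C X Y" "c \<in> Hom C Y Q" "c \<cdot> f = \<zero>\<zero> X Q" "X \<in> S" "Y \<in> S" "Q \<in> S"
    and "\<And>L l. \<lbrakk>L \<in> S; l \<in> Hom C Y L; l \<cdot> f = \<zero>\<zero> X L\<rbrakk> \<Longrightarrow> \<exists>u. u \<in> Hom C Q L \<and> u \<cdot> c = l"
    and "\<And>L u. \<lbrakk>L \<in> S; u \<in> Hom C Q L; u \<cdot> c = \<zero>\<zero> Y L\<rbrakk> \<Longrightarrow> u = \<zero>\<zero> Q L"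
  shows "is_cokernel_of (full_subcategory C S) c f"
proof -
  have "\<exists>!u. u \<in> Hom C Q L \<and> u \<cdot> c = l" if "L \<in> S" "l \<in> Hom C Y L" "l \<cdot> f = \<zero>\<zero> X L" for L l
    using assms(7)[OF that] epi_if_cancel_Zero[OF assms(2)] assms(8)[OF that(1)] by metis
  then show ?thesis
    unfolding is_cokernel_of_def Hom_full_subcategory full_subcategory_simps
    using assms(1-6) by (intro exI[of _ X] exI[of _ Y] exI[of _ Q]) simp
qed

text \<open>\<open>is_kernel_of\<close> hides the objects behind existential quantifiers; the typing
  of f identifies two of them with X and Y. Two lifts u, v with k u = k v are factorisations of one
  map killed by f, hence equal.\<close>

lemma is_kernel_of_full_subcategoryD:
  assumes k: "is_kernel_of (full_subcategory C S) k f" and f: "f \<in> Hom C X Y"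
  obtains K where "k \<in> Hom C K X" "f \<cdot> k = \<zero>\<zero> K Y" "K \<in> S" "X \<in> S" "Y \<in> S"
    and "\<And>L l. \<lbrakk>L \<in> S; l \<in> Hom C L X; f \<cdot> l = \<zero>\<zero> L Y\<rbrakk> \<Longrightarrow> \<exists>u. u \<in> Hom C L K \<and> k \<cdot> u = l"
    and "\<And>L u v. \<lbrakk>L \<in> S; u \<in> Hom C L K; v \<in> Hom C L K; k \<cdot> u = k \<cdot> v\<rbrakk> \<Longrightarrow> u = v"
proof -
  obtain K X' Y' where *: "k \<in> Hom C K X'" "f \<in> Hom C X' Y'" "f \<cdot> k = \<zero>\<zero> K Y'"
    "K \<in> S" "X' \<in> S" "Y' \<in> S"
    and U: "\<And>L l. \<lbrakk>L \<in> S; L \<in> Obj C; l \<in> Hom C L X'; f \<cdot> l = \<zero>\<zero> L Y'\<rbrakk>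
      \<Longrightarrow> \<exists>!u. u \<in> Hom C L K \<and> k \<cdot> u = l"
    using k unfolding is_kernel_of_def Hom_full_subcategory full_subcategory_simps
    by (force split: if_splits)
  have XY: "X' = X" "Y' = Y"
    using *(2) f by (auto simp: Hom_def)
  have U': "\<exists>!u. u \<in> Hom C L K \<and> k \<cdot> u = l" if "L \<in> S" "l \<in> Hom C L X" "f \<cdot> l = \<zero>\<zero> L Y" for L l
    using U that XY Hom_Obj(1)[OF that(2)] by blast
  have "u = v" if L: "L \<in> S" "u \<in> Hom C L K" "v \<in> Hom C L K" "k \<cdot> u = k \<cdot> v" for L u v
  proof -
    have "f \<cdot> (k \<cdot> u) = \<zero>\<zero> L Y"
      using Comp_assoc[OF L(2) *(1,2)] *(3) Comp_Zero_left[OF L(2) Hom_Obj(2)[OF f]] XY by simp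
    then show ?thesis
      using U'[OF L(1) Comp_Hom[OF L(2) *(1)[unfolded XY]]] L by metis
  qed
  then show thesis
    using that[of K] * U' XY by blast
qed

lemma is_cokernel_of_full_subcategoryD:
  assumes c: "is_cokernel_of (full_subcategory C S) c f" and f: "f \<in> Hom C X Y"
  obtains Q where "c \<in> Hom C Y Q" "c \<cdot> f = \<zero>\<zero> X Q" "X \<in> S" "Y \<in> S" "Q \<in> S"
    and "\<And>L l. \<lbrakk>L \<in> S; l \<in> Hom C Y L; l \<cdot> f = \<zero>\<zero> X L\<rbrakk> \<Longrightarrow> \<exists>u. u \<in> Hom C Q L \<and> u \<cdot> c = l"
    and "\<And>L u v. \<lbrakk>L \<in> S; u \<in> Hom C Q L; v \<in> Hom C Q L; u \<cdot> c = v \<cdot> c\<rbrakk> \<Longrightarrow> u = v"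
proof -
  obtain X' Y' Q where *: "f \<in> Hom C X' Y'" "c \<in> Hom C Y' Q" "c \<cdot> f = \<zero>\<zero> X' Q"
    "X' \<in> S" "Y' \<in> S" "Q \<in> S"
    and U: "\<And>L l. \<lbrakk>L \<in> S; L \<in> Obj C; l \<in> Hom C Y' L; l \<cdot> f = \<zero>\<zero> X' L\<rbrakk>
      \<Longrightarrow> \<exists>!u. u \<in> Hom C Q L \<and> u \<cdot> c = l"
    using c unfolding is_cokernel_of_def Hom_full_subcategory full_subcategory_simps
    by (force split: if_splits)
  have XY: "X' = X" "Y' = Y"
    using *(1) f by (auto simp: Hom_def)
  have U': "\<exists>!u. u \<in> Hom C Q L \<and> u \<cdot> c = l" if "L \<in> S" "l \<in> Hom C Y L" "l \<cdot> f = \<zero>\<zero> X L" for L l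
    using U that XY Hom_Obj(2)[OF that(2)] by blast
  have "u = v" if L: "L \<in> S" "u \<in> Hom C Q L" "v \<in> Hom C Q L" "u \<cdot> c = v \<cdot> c" for L u v
  proof -
    have "u \<cdot> c \<cdot> f = \<zero>\<zero> X L"
      using Comp_assoc[OF *(1,2) L(2)] *(3) Comp_Zero_right[OF L(2) Hom_Obj(1)[OF f]] XY by simp
    then show ?thesis
      using U'[OF L(1) Comp_Hom[OF *(2)[unfolded XY] L(2)]] L by metis
  qed
  then show thesis
    using that[of Q] * U' XY by blast
qed

end

context additive_category
begin

text \<open>The sum decomposition in \<open>closed\<close> splits any test map to or from P into
  parts passing through X and Y, which suits classes defined by orthogonality.\<close>

lemma full_subcategory_additive:
  assumes zero: "\<And>Z. is_zero_object C Z \<Longrightarrow> Z \<in> S"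
    and closed: "\<And>X Y P i j p q. \<lbrakk>X \<in> S; Y \<in> S; i \<in> Hom C X P; j \<in> Hom C Y P; p \<in> Hom C P X;
        q \<in> Hom C P Y; (i \<cdot> p) \<boxplus> (j \<cdot> q) = \<iota> P\<rbrakk> \<Longrightarrow> P \<in> S"
  shows "additive_category (full_subcategory C S)"
proof (intro additive_category.intro additive_category_axioms.intro preadditive_category.intro
    preadditive_category_axioms.intro category.intro)
  let ?A = "full_subcategory C S"
  note [simp] = full_subcategory_simps Hom_full_subcategory
  show "Dom ?A f \<in> Obj ?A" "Cod ?A f \<in> Obj ?A" if "f \<in> Arr ?A" for f
    using that Dom_Obj Cod_Obj by auto
  show "Ident ?A X \<in> Hom ?A X X" if "X \<in> Obj ?A" for X
    using that Ident_Hom by auto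
  show "Comp ?A g f \<in> Hom ?A X Z" if "f \<in> Hom ?A X Y" "g \<in> Hom ?A Y Z" for f g X Y Z
    using that Comp_Hom by (auto split: if_splits)
  show "Comp ?A (Comp ?A h g) f = Comp ?A h (Comp ?A g f)"
    if "f \<in> Hom ?A W X" "g \<in> Hom ?A X Y" "h \<in> Hom ?A Y Z" for f g h W X Y Z
    using that Comp_assoc by (auto split: if_splits)
  show "Comp ?A f (Ident ?A X) = f" "Comp ?A (Ident ?A Y) f = f" if "f \<in> Hom ?A X Y" for f X Y
    using that Comp_Ident_right Comp_Ident_left by (auto split: if_splits)
  show "comm_group (Hom_group ?A X Y)" if "X \<in> Obj ?A" "Y \<in> Obj ?A" for X Y
  proof -
    have "Hom_group ?A X Y = Hom_group C X Y"
      using that by (simp add: Hom_group_def)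
    then show ?thesis
      using Hom_comm_group that by simp
  qed
  show "Comp ?A g (Add ?A f f') = Add ?A (Comp ?A g f) (Comp ?A g f')"
    if "f \<in> Hom ?A X Y" "f' \<in> Hom ?A X Y" "g \<in> Hom ?A Y Z" for f f' g X Y Z
    using that Comp_Add_right by (auto split: if_splits)
  show "Comp ?A (Add ?A g g') f = Add ?A (Comp ?A g f) (Comp ?A g' f)"
    if "f \<in> Hom ?A X Y" "g \<in> Hom ?A Y Z" "g' \<in> Hom ?A Y Z" for f g g' X Y Z
    using that Comp_Add_left by (auto split: if_splits)
  show "\<exists>Z. is_zero_object ?A Z"
  proof -
    obtain Z where Z: "is_zero_object C Z"
      using zero_object by blast
    then have "Z \<in> S"
      by (rule zero)
    then have "is_zero_object ?A Z"
      using Z by (simp add: is_zero_object_def)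
    then show ?thesis
      by blast
  qed
  show X: "\<exists>P \<in> Obj ?A. \<exists>i \<in> Hom ?A X P. \<exists>j \<in> Hom ?A Y P. \<exists>p \<in> Hom ?A P X. \<exists>q \<in> Hom ?A P Y.
      Comp ?A p i = Ident ?A X \<and> Comp ?A q j = Ident ?A Y \<and> Comp ?A p j = Zero ?A Y X \<and>
      Comp ?A q i = Zero ?A X Y \<and> Add ?A (Comp ?A i p) (Comp ?A j q) = Ident ?A P"
    if XY: "X \<in> Obj ?A" "Y \<in> Obj ?A" for X Y
  proof -
    from XY have XY': "X \<in> S" "Y \<in> S" "X \<in> Obj C" "Y \<in> Obj C"
      by auto
    obtain P i j p q where *: "P \<in> Obj C" "i \<in> Hom C X P" "j \<in> Hom C Y P" "p \<in> Hom C P X"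
      "q \<in> Hom C P Y" "p \<cdot> i = \<iota> X" "q \<cdot> j = \<iota> Y" "p \<cdot> j = \<zero>\<zero> Y X" "q \<cdot> i = \<zero>\<zero> X Y"
      "(i \<cdot> p) \<boxplus> (j \<cdot> q) = \<iota> P"
      using biproduct[OF XY'(3,4)] by blast
    moreover have "P \<in> S"
      using closed XY' * by blast
    ultimately show ?thesis
      using XY' by (intro bexI[of _ P] bexI[of _ i] bexI[of _ j] bexI[of _ p] bexI[of _ q]) auto
  qed
qed

end

section \<open>The heart of a normal interval\<close>

locale normal_torsion_interval = triangulated_category D
  for D :: "('o, 'm, 'x) triangulated_data_scheme" (structure) +
  fixes T1 F1 T2 F2 :: "'o set"
  assumes pair1: "s_torsion_pair D (T1, F1)"
    and pair2: "s_torsion_pair D (T2, F2)"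
    and T1_le_T2: "T1 \<subseteq> T2"
    and normal: "Eneg1_vanishes D T2 F1"
begin

abbreviation "\<H> \<equiv> F1 \<inter> T2"
abbreviation "HC \<equiv> full_subcategory D \<H>"

lemmas T1_F1_zero = s_torsion_pairD(6)[OF pair1]
lemmas T2_F2_zero = s_torsion_pairD(6)[OF pair2]
lemmas F1I = torsion_free_if_orthogonal[OF pair1]
lemmas T2I = torsion_if_orthogonal[OF pair2]

section \<open>Closure properties of F1, T2 and the heart\<close>

lemma T2_F1_shift_zero:
  "\<lbrakk>X \<in> T2; Y \<in> F1; f \<in> Hom D (ShO D X) Y\<rbrakk> \<Longrightarrow> f = \<zero>\<zero> (ShO D X) Y"
  using Eneg1_vanishes_shift normal s_torsion_pairD(1)[OF pair2] by blast

text \<open>Right orthogonals reverse inclusions: what is orthogonal to T2 is orthogonal to the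
  smaller T1.\<close>

lemma F2_le_F1: "F2 \<subseteq> F1"
  using F1I T2_F2_zero T1_le_T2 s_torsion_pairD(2)[OF pair2] by blast

lemma F1_extension:
  assumes t: "dist_triangle D X Y Z f g h" and XZ: "X \<in> F1" "Z \<in> F1"
  shows "Y \<in> F1"
proof (rule F1I)
  note H = dist_triangle_Hom[OF t] and O = dist_triangle_Obj[OF t]
  show "Y \<in> Obj D"
    by (rule O(2))
  show "t = \<zero>\<zero> S Y" if S: "S \<in> T1" "t \<in> Hom D S Y" for S t
  proof -
    obtain s where s: "s \<in> Hom D S X" "t = f \<cdot> s"
      using dist_exact_cov[OF t S(2) T1_F1_zero[OF S(1) XZ(2) Comp_Hom[OF S(2) H(2)]]] by blast
    then show ?thesis
      using T1_F1_zero[OF S(1) XZ(1) s(1)] Comp_Zero_right[OF H(1) Hom_Obj(1)[OF S(2)]] by simp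
  qed
qed

lemma T2_extension:
  assumes t: "dist_triangle D X Y Z f g h" and XZ: "X \<in> T2" "Z \<in> T2"
  shows "Y \<in> T2"
proof (rule T2I)
  note H = dist_triangle_Hom[OF t] and O = dist_triangle_Obj[OF t]
  show "Y \<in> Obj D"
    by (rule O(2))
  show "t = \<zero>\<zero> Y S" if S: "S \<in> F2" "t \<in> Hom D Y S" for S t
  proof -
    obtain s where s: "s \<in> Hom D Z S" "t = s \<cdot> g"
      using dist_exact_contra[OF t S(2) T2_F2_zero[OF XZ(1) S(1) Comp_Hom[OF H(1) S(2)]]] by blast
    then show ?thesis
      using T2_F2_zero[OF XZ(2) S(1) s(1)] Comp_Zero_left[OF H(2) Hom_Obj(2)[OF S(2)]] by simp
  qed
qed

text \<open>A map from S in T1 to X dies in Y, so it is controlled by Hom(\<Sigma>S, Z). This group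
  vanishes because T1 lies in T2 and Z in F1.\<close>

lemma fibre_F1:
  assumes t: "dist_triangle D X Y Z f g h" and YZ: "Y \<in> F1" "Z \<in> F1"
  shows "X \<in> F1"
proof (rule F1I)
  note H = dist_triangle_Hom[OF t] and O = dist_triangle_Obj[OF t]
  show "X \<in> Obj D"
    by (rule O(1))
  show "t = \<zero>\<zero> S X" if S: "S \<in> T1" "t \<in> Hom D S X" for S t
    using fibre_cancel[OF t S(2) T1_F1_zero[OF S(1) YZ(1) Comp_Hom[OF S(2) H(1)]]]
      T2_F1_shift_zero[OF subsetD[OF T1_le_T2 S(1)] YZ(2)] by blast
qed

text \<open>A map from Z to S in F2 dies on Y, so it factors through \<Sigma>X, and Hom(\<Sigma>X,
  S) = 0 as S also lies in F1.\<close>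

lemma cone_T2:
  assumes t: "dist_triangle D X Y Z f g h" and XY: "X \<in> T2" "Y \<in> T2"
  shows "Z \<in> T2"
proof (rule T2I)
  note H = dist_triangle_Hom[OF t] and O = dist_triangle_Obj[OF t]
  show "Z \<in> Obj D"
    by (rule O(3))
  show "t = \<zero>\<zero> Z S" if S: "S \<in> F2" "t \<in> Hom D Z S" for S t
    using cofibre_cancel[OF t S(2) T2_F2_zero[OF XY(2) S(1) Comp_Hom[OF H(2) S(2)]]]
      T2_F1_shift_zero[OF XY(1) subsetD[OF F2_le_F1 S(1)]] by blast
qed

lemma heart_extension:
  assumes "dist_triangle D X Y Z f g h" "X \<in> \<H>" "Z \<in> \<H>"
  shows "Y \<in> \<H>"
  using F1_extension[OF assms(1)] T2_extension[OF assms(1)] assms(2,3) by blast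

section \<open>Kernels and cokernels in the heart\<close>

lemma heart_kernel:
  assumes f: "f \<in> Hom D X Y" and XY: "X \<in> \<H>" "Y \<in> \<H>"
  obtains K T F k d \<tau> p \<delta> where "dist_triangle D K X Y k f d" "dist_triangle D T K F \<tau> p \<delta>"
    "T \<in> \<H>" "F \<in> F2" "is_kernel_of HC (k \<cdot> \<tau>) f"
proof -
  obtain K k d where t: "dist_triangle D K X Y k f d"
    using fibre_exists f by blast
  note H = dist_triangle_Hom[OF t] and O = dist_triangle_Obj[OF t]
  \<comment> \<open>K need not lie in T2, and its T2-part T repairs this. Both triangles are handed
    on because the cone of a kernel is later controlled through F.\<close>
  obtain T F \<tau> p \<delta> where TF: "T \<in> T2" "F \<in> F2" and t': "dist_triangle D T K F \<tau> p \<delta>"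
    using s_torsion_pairD(8)[OF pair2 O(1)] by blast
  note H' = dist_triangle_Hom[OF t'] and O' = dist_triangle_Obj[OF t']
  have "K \<in> F1"
    using fibre_F1[OF t] XY by blast
  \<comment> \<open>T is itself the fibre of K -> F with F in F2, hence in F1, so
    \<open>fibre_F1\<close> applies a second time.\<close>
  then have T: "T \<in> \<H>"
    using fibre_F1[OF t'] TF F2_le_F1 by blast
  have "is_kernel_of HC (k \<cdot> \<tau>) f"
  proof (rule is_kernel_of_full_subcategoryI[OF Comp_Hom[OF H'(1) H(1)] f _ T XY])
    show "f \<cdot> (k \<cdot> \<tau>) = \<zero>\<zero> T Y"
      using Comp_assoc[OF H'(1) H(1,2)] dist_comp_Zero[OF t] Comp_Zero_left[OF H'(1) O(3)] by simp
    show "\<exists>u. u \<in> Hom D L T \<and> k \<cdot> \<tau> \<cdot> u = l"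
      if L: "L \<in> \<H>" "l \<in> Hom D L X" "f \<cdot> l = \<zero>\<zero> L Y" for L l
    proof -
      obtain m where m: "m \<in> Hom D L K" "l = k \<cdot> m"
        using dist_exact_cov[OF t L(2,3)] by blast
      \<comment> \<open>L lies in T2 and F in F2, so the lift of l to K falls into T.\<close>
      have "p \<cdot> m = \<zero>\<zero> L F"
        using T2_F2_zero[OF _ TF(2) Comp_Hom[OF m(1) H'(2)]] L by blast
      then obtain u where "u \<in> Hom D L T" "m = \<tau> \<cdot> u"
        using dist_exact_cov[OF t' m(1)] by blast
      then show ?thesis
        using Comp_assoc[OF _ H'(1) H(1)] m by blast
    qed
    show "u = \<zero>\<zero> L T" if L: "L \<in> \<H>" "u \<in> Hom D L T" "k \<cdot> \<tau> \<cdot> u = \<zero>\<zero> L X" for L u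
    proof -
      have "k \<cdot> (\<tau> \<cdot> u) = \<zero>\<zero> L X"
        using Comp_assoc[OF L(2) H'(1) H(1)] L(3) by simp
      then have "\<tau> \<cdot> u = \<zero>\<zero> L K"
        using fibre_cancel[OF t Comp_Hom[OF L(2) H'(1)]] T2_F1_shift_zero[of L Y] L XY by blast
      then show ?thesis
        using fibre_cancel[OF t' L(2)] T2_F1_shift_zero[of L F] L TF F2_le_F1 by blast
    qed
  qed
  then show thesis
    using that t t' T TF by blast
qed

text \<open>The cone C lies in T2 but may have a T1-part T. Its quotient F is the cone of a map
  inside T2, so it stays in T2, and maps from C to the heart kill T because the heart lies in
  F1.\<close>

lemma heart_cokernel:
  assumes f: "f \<in> Hom D X Y" and XY: "X \<in> \<H>" "Y \<in> \<H>"
  obtains C T F c w \<tau> p \<delta> where "dist_triangle D X Y C f c w" "dist_triangle D T C F \<tau> p \<delta>"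
    "T \<in> T1" "F \<in> \<H>" "is_cokernel_of HC (p \<cdot> c) f"
proof -
  obtain C c w where t: "dist_triangle D X Y C f c w"
    using TR1_cone f by blast
  note H = dist_triangle_Hom[OF t] and O = dist_triangle_Obj[OF t]
  obtain T F \<tau> p \<delta> where TF: "T \<in> T1" "F \<in> F1" and t': "dist_triangle D T C F \<tau> p \<delta>"
    using s_torsion_pairD(8)[OF pair1 O(3)] by blast
  note H' = dist_triangle_Hom[OF t'] and O' = dist_triangle_Obj[OF t']
  have "C \<in> T2"
    using cone_T2[OF t] XY by blast
  then have F: "F \<in> \<H>"
    using cone_T2[OF t'] TF T1_le_T2 by blast
  have "is_cokernel_of HC (p \<cdot> c) f"
  proof (rule is_cokernel_of_full_subcategoryI[OF f Comp_Hom[OF H(2) H'(2)] _ XY F])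
    show "p \<cdot> c \<cdot> f = \<zero>\<zero> X F"
      using Comp_assoc[OF H(1,2) H'(2)] dist_comp_Zero[OF t] Comp_Zero_right[OF H'(2) O(1)] by simp
    show "\<exists>u. u \<in> Hom D F L \<and> u \<cdot> (p \<cdot> c) = l"
      if L: "L \<in> \<H>" "l \<in> Hom D Y L" "l \<cdot> f = \<zero>\<zero> X L" for L l
    proof -
      obtain m where m: "m \<in> Hom D C L" "l = m \<cdot> c"
        using dist_exact_contra[OF t L(2,3)] by blast
      have "m \<cdot> \<tau> = \<zero>\<zero> T L"
        using T1_F1_zero[OF TF(1) _ Comp_Hom[OF H'(1) m(1)]] L by blast
      then obtain u where "u \<in> Hom D F L" "m = u \<cdot> p"
        using dist_exact_contra[OF t' m(1)] by blast
      then show ?thesis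
        using Comp_assoc[OF H(2) H'(2)] m by metis
    qed
    show "u = \<zero>\<zero> F L" if L: "L \<in> \<H>" "u \<in> Hom D F L" "u \<cdot> (p \<cdot> c) = \<zero>\<zero> Y L" for L u
    proof -
      have "u \<cdot> p \<cdot> c = \<zero>\<zero> Y L"
        using Comp_assoc[OF H(2) H'(2) L(2)] L(3) by simp
      then have "u \<cdot> p = \<zero>\<zero> C L"
        using cofibre_cancel[OF t Comp_Hom[OF H'(2) L(2)]] T2_F1_shift_zero[of X L] L XY by blast
      then show ?thesis
        using cofibre_cancel[OF t' L(2)] T2_F1_shift_zero[of T L] L TF T1_le_T2 by blast
    qed
  qed
  then show thesis
    using that t t' F TF by blast
qed

text \<open>Exactness gives the factorisations. Their uniqueness is obstructed by Hom(\<Sigma>L, Z)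
  and Hom(\<Sigma>X, L), which normality annihilates for L in the heart.\<close>

lemma kernel_cokernel_of_triangle:
  assumes t: "dist_triangle D X Y Z f g h" and XYZ: "X \<in> \<H>" "Y \<in> \<H>" "Z \<in> \<H>"
  shows "is_kernel HC f" "is_cokernel HC g"
proof -
  note H = dist_triangle_Hom[OF t] and O = dist_triangle_Obj[OF t]
  have "is_kernel_of HC f g"
  proof (rule is_kernel_of_full_subcategoryI[OF H(1,2) dist_comp_Zero[OF t] XYZ])
    show "\<exists>u. u \<in> Hom D L X \<and> f \<cdot> u = l" if "L \<in> \<H>" "l \<in> Hom D L Y" "g \<cdot> l = \<zero>\<zero> L Z" for L l
      using dist_exact_cov[OF t that(2,3)] by blast
    show "u = \<zero>\<zero> L X" if "L \<in> \<H>" "u \<in> Hom D L X" "f \<cdot> u = \<zero>\<zero> L Y" for L u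
      using fibre_cancel[OF t that(2,3)] T2_F1_shift_zero[of L Z] that XYZ by blast
  qed
  moreover have "g \<in> Arr HC" "f \<in> Arr HC"
    using H XYZ by (auto simp: full_subcategory_simps Hom_def)
  ultimately show "is_kernel HC f"
    unfolding is_kernel_def by blast
  have "is_cokernel_of HC g f"
  proof (rule is_cokernel_of_full_subcategoryI[OF H(1,2) dist_comp_Zero[OF t] XYZ])
    show "\<exists>u. u \<in> Hom D Z L \<and> u \<cdot> g = l" if "L \<in> \<H>" "l \<in> Hom D Y L" "l \<cdot> f = \<zero>\<zero> X L" for L l
      using dist_exact_contra[OF t that(2,3)] by blast
    show "u = \<zero>\<zero> Z L" if "L \<in> \<H>" "u \<in> Hom D Z L" "u \<cdot> g = \<zero>\<zero> Y L" for L u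
      using cofibre_cancel[OF t that(2,3)] T2_F1_shift_zero[of X L] that XYZ by blast
  qed
  then show "is_cokernel HC g"
    unfolding is_cokernel_def using \<open>f \<in> Arr HC\<close> by blast
qed

section \<open>Triangles recovered from kernels and cokernels\<close>

lemma Arr_heartD:
  assumes "f \<in> Arr HC"
  shows "f \<in> Hom D (Dom D f) (Cod D f)" "Dom D f \<in> \<H>" "Cod D f \<in> \<H>"
  using assms by (simp_all add: full_subcategory_simps Hom_def)

lemma triangle_of_kernel:
  assumes ker: "is_kernel HC f" and f: "f \<in> Hom D X Y"
  obtains C c w where "dist_triangle D X Y C f c w" "X \<in> \<H>" "Y \<in> \<H>" "C \<in> \<H>"
proof -
  obtain g where "g \<in> Arr HC" and fg: "is_kernel_of HC f g"
    using ker unfolding is_kernel_def by blast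
  note g' = Arr_heartD[OF \<open>g \<in> Arr HC\<close>]
  obtain X' where "f \<in> Hom D X' (Dom D g)" "X' \<in> \<H>"
    using is_kernel_of_full_subcategoryD[OF fg g'(1)] by metis
  then have X: "X \<in> \<H>" and Y: "Dom D g = Y"
    using f by (auto simp: Hom_def)
  obtain Z where g: "g \<in> Hom D Y Z" and YZ: "Y \<in> \<H>" "Z \<in> \<H>"
    using g' Y by auto
  have gf: "g \<cdot> f = \<zero>\<zero> X Z"
    and f_univ: "\<And>L l. \<lbrakk>L \<in> \<H>; l \<in> Hom D L Y; g \<cdot> l = \<zero>\<zero> L Z\<rbrakk> \<Longrightarrow> \<exists>u. u \<in> Hom D L X \<and> f \<cdot> u = l"
    and f_mono: "\<And>L u v. \<lbrakk>L \<in> \<H>; u \<in> Hom D L X; v \<in> Hom D L X; f \<cdot> u = f \<cdot> v\<rbrakk> \<Longrightarrow> u = v"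
  proof -
    obtain X'' where *: "f \<in> Hom D X'' Y" "g \<cdot> f = \<zero>\<zero> X'' Z"
      "\<And>L l. \<lbrakk>L \<in> \<H>; l \<in> Hom D L Y; g \<cdot> l = \<zero>\<zero> L Z\<rbrakk> \<Longrightarrow> \<exists>u. u \<in> Hom D L X'' \<and> f \<cdot> u = l"
      "\<And>L u v. \<lbrakk>L \<in> \<H>; u \<in> Hom D L X''; v \<in> Hom D L X''; f \<cdot> u = f \<cdot> v\<rbrakk> \<Longrightarrow> u = v"
      using is_kernel_of_full_subcategoryD[OF fg g] by metis
    have "X'' = X"
      using *(1) f by (auto simp: Hom_def)
    then show "g \<cdot> f = \<zero>\<zero> X Z"
      "\<And>L l. \<lbrakk>L \<in> \<H>; l \<in> Hom D L Y; g \<cdot> l = \<zero>\<zero> L Z\<rbrakk> \<Longrightarrow> \<exists>u. u \<in> Hom D L X \<and> f \<cdot> u = l"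
      "\<And>L u v. \<lbrakk>L \<in> \<H>; u \<in> Hom D L X; v \<in> Hom D L X; f \<cdot> u = f \<cdot> v\<rbrakk> \<Longrightarrow> u = v"
      using * by blast+
  qed
  obtain K T F k d \<tau> p \<delta> where tK: "dist_triangle D K Y Z k g d"
    and tT: "dist_triangle D T K F \<tau> p \<delta>" and TF: "T \<in> \<H>" "F \<in> F2"
    and ker': "is_kernel_of HC (k \<cdot> \<tau>) g"
    using heart_kernel[OF g YZ] by metis
  note HK = dist_triangle_Hom[OF tK] and HT = dist_triangle_Hom[OF tT]
  have k\<tau>: "k \<cdot> \<tau> \<in> Hom D T Y"
    by (rule Comp_Hom[OF HT(1) HK(1)])
  obtain a where a: "a \<in> Hom D X T" "k \<cdot> \<tau> \<cdot> a = f"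
  proof -
    obtain T' where *: "k \<cdot> \<tau> \<in> Hom D T' Y"
      "\<And>L l. \<lbrakk>L \<in> \<H>; l \<in> Hom D L Y; g \<cdot> l = \<zero>\<zero> L Z\<rbrakk> \<Longrightarrow> \<exists>u. u \<in> Hom D L T' \<and> k \<cdot> \<tau> \<cdot> u = l"
      using is_kernel_of_full_subcategoryD[OF ker' g] by metis
    have "T' = T"
      using *(1) k\<tau> by (auto simp: Hom_def)
    then show thesis
      using *(2)[OF X f gf] that by blast
  qed
  have "g \<cdot> (k \<cdot> \<tau>) = \<zero>\<zero> T Z"
    using Comp_assoc[OF HT(1) HK(1,2)] dist_comp_Zero[OF tK]
      Comp_Zero_left[OF HT(1) Hom_Obj(2)[OF g]] by simp
  then obtain a' where a': "a' \<in> Hom D T X" "f \<cdot> a' = k \<cdot> \<tau>"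
    using f_univ[OF TF(1) k\<tau>] by blast
  \<comment> \<open>The left inverse a' will later strip a from the equation \<Sigma>a w t =
    0.\<close>
  have "f \<cdot> (a' \<cdot> a) = f \<cdot> \<iota> X"
    using Comp_assoc[OF a(1) a'(1) f] a(2) a'(2) Comp_Ident_right[OF f] by simp
  then have a'a: "a' \<cdot> a = \<iota> X"
    using f_mono[OF X Comp_Hom[OF a(1) a'(1)] Ident_Hom[OF Hom_Obj(1)[OF f]]] by blast
  obtain C c w where tC: "dist_triangle D X Y C f c w"
    using TR1_cone f by blast
  note HC = dist_triangle_Hom[OF tC] and OC = dist_triangle_Obj[OF tC]
  have sq: "\<iota> Y \<cdot> f = k \<cdot> (\<tau> \<cdot> a)"
    using Comp_assoc[OF a(1) HT(1) HK(1)] a(2) Comp_Ident_left[OF f] by simp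
  \<comment> \<open>With the identity on Y, \<open>TR3\<close> makes \<Sigma>(\<tau> a) w pass
    through Z, an object of F1 that receives only zero from T1.\<close>
  obtain c' where c': "c' \<in> Hom D C Z" "ShA D (\<tau> \<cdot> a) \<cdot> w = d \<cdot> c'"
    using TR3[OF tC tK Comp_Hom[OF a(1) HT(1)] Ident_Hom[OF OC(2)] sq] by blast
  have "C \<in> F1"
  proof (rule F1I[OF OC(3)])
    fix S t assume S: "S \<in> T1" and t: "t \<in> Hom D S C"
    have wt: "w \<cdot> t \<in> Hom D S (ShO D X)"
      by (rule Comp_Hom[OF t HC(3)])
    have awt: "ShA D a \<cdot> (w \<cdot> t) \<in> Hom D S (ShO D T)"
      by (rule Comp_Hom[OF wt ShA_Hom[OF a(1)]])
    have "ShA D \<tau> \<cdot> (ShA D a \<cdot> (w \<cdot> t)) = ShA D (\<tau> \<cdot> a) \<cdot> (w \<cdot> t)"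
      using Comp_assoc[OF wt ShA_Hom[OF a(1)] ShA_Hom[OF HT(1)]] ShA_Comp[OF a(1) HT(1)] by simp
    also have "\<dots> = d \<cdot> (c' \<cdot> t)"
      using Comp_assoc[OF t HC(3) ShA_Hom[OF Comp_Hom[OF a(1) HT(1)]]] Comp_assoc[OF t c'(1) HK(3)] c'(2)
      by simp
    also have "c' \<cdot> t = \<zero>\<zero> S Z"
      using T1_F1_zero[OF S _ Comp_Hom[OF t c'(1)]] YZ by blast
    also have "d \<cdot> \<zero>\<zero> S Z = \<zero>\<zero> S (ShO D K)"
      by (rule Comp_Zero_right[OF HK(3) Hom_Obj(1)[OF t]])
    \<comment> \<open>A map to \<Sigma>T killed by \<Sigma>\<tau> comes from F, and S in T2 has only
      the zero map to F.\<close>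
    finally obtain y where y: "y \<in> Hom D S F" "ShA D a \<cdot> (w \<cdot> t) = \<delta> \<cdot> y"
      using dist_exact_cov_shift[OF tT awt] by blast
    have "y = \<zero>\<zero> S F"
      using T2_F2_zero[OF _ TF(2) y(1)] S T1_le_T2 by blast
    then have "ShA D a \<cdot> (w \<cdot> t) = \<zero>\<zero> S (ShO D T)"
      using y(2) Comp_Zero_right[OF HT(3) Hom_Obj(1)[OF t]] by simp
    then have "ShA D (a' \<cdot> a) \<cdot> (w \<cdot> t) = \<zero>\<zero> S (ShO D X)"
      using Comp_assoc[OF wt ShA_Hom[OF a(1)] ShA_Hom[OF a'(1)]] ShA_Comp[OF a(1) a'(1)]
        Comp_Zero_right[OF ShA_Hom[OF a'(1)] Hom_Obj(1)[OF t]] by simp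
    then have "w \<cdot> t = \<zero>\<zero> S (ShO D X)"
      using a'a ShA_Ident[OF OC(1)] Comp_Ident_left[OF wt] by simp
    then obtain s where s: "s \<in> Hom D S Y" "t = c \<cdot> s"
      using dist_exact_cov[OF rotate[OF tC] t] by blast
    then show "t = \<zero>\<zero> S C"
      using T1_F1_zero[OF S _ s(1)] YZ Comp_Zero_right[OF HC(2) Hom_Obj(1)[OF t]] by simp
  qed
  moreover have "C \<in> T2"
    using cone_T2[OF tC] X YZ by blast
  ultimately show thesis
    using that tC X YZ by blast
qed

text \<open>The fibre of the explicit cokernel p c is an extension of T by W, both in T2; a and a'
  compare g with p c. The chase runs on \<Sigma>t d, the obstruction to extending t : K -> S over
  X.\<close>

lemma triangle_of_cokernel:
  assumes coker: "is_cokernel HC g" and g: "g \<in> Hom D X Y"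
  obtains K k d where "dist_triangle D K X Y k g d" "K \<in> \<H>" "X \<in> \<H>" "Y \<in> \<H>"
proof -
  obtain f where "f \<in> Arr HC" and gf: "is_cokernel_of HC g f"
    using coker unfolding is_cokernel_def by blast
  note f' = Arr_heartD[OF \<open>f \<in> Arr HC\<close>]
  obtain Y' where "g \<in> Hom D (Cod D f) Y'" "Y' \<in> \<H>"
    using is_cokernel_of_full_subcategoryD[OF gf f'(1)] by metis
  then have Y: "Y \<in> \<H>" and X: "Cod D f = X"
    using g by (auto simp: Hom_def)
  obtain W where f: "f \<in> Hom D W X" and WX: "W \<in> \<H>" "X \<in> \<H>"
    using f' X by auto
  have gf0: "g \<cdot> f = \<zero>\<zero> W Y"
    and g_univ: "\<And>L l. \<lbrakk>L \<in> \<H>; l \<in> Hom D X L; l \<cdot> f = \<zero>\<zero> W L\<rbrakk> \<Longrightarrow> \<exists>u. u \<in> Hom D Y L \<and> u \<cdot> g = l"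
    and g_epi: "\<And>L u v. \<lbrakk>L \<in> \<H>; u \<in> Hom D Y L; v \<in> Hom D Y L; u \<cdot> g = v \<cdot> g\<rbrakk> \<Longrightarrow> u = v"
  proof -
    obtain Y'' where *: "g \<in> Hom D X Y''" "g \<cdot> f = \<zero>\<zero> W Y''"
      "\<And>L l. \<lbrakk>L \<in> \<H>; l \<in> Hom D X L; l \<cdot> f = \<zero>\<zero> W L\<rbrakk> \<Longrightarrow> \<exists>u. u \<in> Hom D Y'' L \<and> u \<cdot> g = l"
      "\<And>L u v. \<lbrakk>L \<in> \<H>; u \<in> Hom D Y'' L; v \<in> Hom D Y'' L; u \<cdot> g = v \<cdot> g\<rbrakk> \<Longrightarrow> u = v"
      using is_cokernel_of_full_subcategoryD[OF gf f] by metis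
    have "Y'' = Y"
      using *(1) g by (auto simp: Hom_def)
    then show "g \<cdot> f = \<zero>\<zero> W Y"
      "\<And>L l. \<lbrakk>L \<in> \<H>; l \<in> Hom D X L; l \<cdot> f = \<zero>\<zero> W L\<rbrakk> \<Longrightarrow> \<exists>u. u \<in> Hom D Y L \<and> u \<cdot> g = l"
      "\<And>L u v. \<lbrakk>L \<in> \<H>; u \<in> Hom D Y L; v \<in> Hom D Y L; u \<cdot> g = v \<cdot> g\<rbrakk> \<Longrightarrow> u = v"
      using * by blast+
  qed
  obtain C T F c w \<tau> p \<delta> where tC: "dist_triangle D W X C f c w"
    and tT: "dist_triangle D T C F \<tau> p \<delta>" and TF: "T \<in> T1" "F \<in> \<H>"
    and coker': "is_cokernel_of HC (p \<cdot> c) f"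
    using heart_cokernel[OF f WX] by metis
  note HC = dist_triangle_Hom[OF tC] and HT = dist_triangle_Hom[OF tT]
  have pc: "p \<cdot> c \<in> Hom D X F"
    by (rule Comp_Hom[OF HC(2) HT(2)])
  obtain a where a: "a \<in> Hom D F Y" "a \<cdot> (p \<cdot> c) = g"
  proof -
    obtain F' where *: "p \<cdot> c \<in> Hom D X F'"
      "\<And>L l. \<lbrakk>L \<in> \<H>; l \<in> Hom D X L; l \<cdot> f = \<zero>\<zero> W L\<rbrakk> \<Longrightarrow> \<exists>u. u \<in> Hom D F' L \<and> u \<cdot> (p \<cdot> c) = l"
      using is_cokernel_of_full_subcategoryD[OF coker' f] by metis
    have "F' = F"
      using *(1) pc by (auto simp: Hom_def)
    then show thesis
      using *(2)[OF Y g gf0] that by blast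
  qed
  have "p \<cdot> c \<cdot> f = \<zero>\<zero> W F"
    using Comp_assoc[OF HC(1,2) HT(2)] dist_comp_Zero[OF tC]
      Comp_Zero_right[OF HT(2) Hom_Obj(1)[OF f]] by simp
  then obtain a' where a': "a' \<in> Hom D Y F" "a' \<cdot> g = p \<cdot> c"
    using g_univ[OF TF(2) pc] by blast
  have "a \<cdot> a' \<cdot> g = \<iota> Y \<cdot> g"
    using Comp_assoc[OF g a'(1) a(1)] a(2) a'(2) Comp_Ident_left[OF g] by simp
  then have aa': "a \<cdot> a' = \<iota> Y"
    using g_epi[OF Y Comp_Hom[OF a'(1) a(1)] Ident_Hom[OF Hom_Obj(2)[OF g]]] by blast
  obtain K k d where tK: "dist_triangle D K X Y k g d"
    using fibre_exists g by blast
  note HK = dist_triangle_Hom[OF tK] and OK = dist_triangle_Obj[OF tK]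
  have ap: "a \<cdot> p \<in> Hom D C Y"
    by (rule Comp_Hom[OF HT(2) a(1)])
  have sq: "a \<cdot> p \<cdot> c = g \<cdot> \<iota> X"
    using Comp_assoc[OF HC(2) HT(2) a(1)] a(2) Comp_Ident_right[OF g] by simp
  \<comment> \<open>The map e : W -> K rewrites d a p as \<Sigma>e w, so that t meets W, an object
    of T2.\<close>
  obtain e where e: "e \<in> Hom D W K" "ShA D e \<cdot> w = d \<cdot> (a \<cdot> p)"
    using TR3_left[OF tC tK Ident_Hom[OF OK(2)] ap sq] by blast
  have "K \<in> T2"
  proof (rule T2I[OF OK(1)])
    fix S t assume S: "S \<in> F2" and t: "t \<in> Hom D K S"
    have td: "ShA D t \<cdot> d \<in> Hom D Y (ShO D S)"
      by (rule Comp_Hom[OF HK(3) ShA_Hom[OF t]])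
    have tda: "ShA D t \<cdot> d \<cdot> a \<in> Hom D F (ShO D S)"
      by (rule Comp_Hom[OF a(1) td])
    have WS: "W \<in> Obj D" "S \<in> Obj D" "T \<in> Obj D"
      using Hom_Obj f t HT by blast+
    have "ShA D t \<cdot> d \<cdot> a \<cdot> p = ShA D t \<cdot> (d \<cdot> (a \<cdot> p))"
      using Comp_assoc[OF HT(2) a(1) td] Comp_assoc[OF ap HK(3) ShA_Hom[OF t]] by simp
    also have "\<dots> = ShA D (t \<cdot> e) \<cdot> w"
      using Comp_assoc[OF HC(3) ShA_Hom[OF e(1)] ShA_Hom[OF t]] ShA_Comp[OF e(1) t] e(2) by simp
    also have "t \<cdot> e = \<zero>\<zero> W S"
      using T2_F2_zero[OF _ S Comp_Hom[OF e(1) t]] WX by blast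
    also have "ShA D (\<zero>\<zero> W S) \<cdot> w = \<zero>\<zero> C (ShO D S)"
      using ShA_Zero[OF WS(1,2)] Comp_Zero_left[OF HC(3) ShO_Obj[OF WS(2)]] by simp
    \<comment> \<open>A map on F that vanishes after p factors through \<Sigma>T; the factor
      desuspends to a map from T in T1 to S in F2, which is zero.\<close>
    finally obtain s where s: "s \<in> Hom D (ShO D T) (ShO D S)" "ShA D t \<cdot> d \<cdot> a = s \<cdot> \<delta>"
      using dist_exact_contra[OF rotate[OF tT] tda] by blast
    obtain s' where s': "s' \<in> Hom D T S" "ShA D s' = s"
      using ShA_surj[OF s(1)] WS by blast
    have "s' = \<zero>\<zero> T S"
      using T2_F2_zero[OF _ S s'(1)] TF T1_le_T2 by blast
    then have "ShA D t \<cdot> d \<cdot> a = \<zero>\<zero> F (ShO D S)"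
      using s(2) s'(2) ShA_Zero[OF WS(3,2)] Comp_Zero_left[OF HT(3) ShO_Obj[OF WS(2)]] by simp
    then have "ShA D t \<cdot> d \<cdot> (a \<cdot> a') = \<zero>\<zero> Y (ShO D S)"
      using Comp_assoc[OF a'(1) a(1) td] Comp_Zero_left[OF a'(1) ShO_Obj[OF WS(2)]] by simp
    then have "ShA D t \<cdot> d = \<zero>\<zero> Y (ShO D S)"
      using aa' Comp_Ident_right[OF td] by simp
    then obtain r where r: "r \<in> Hom D X S" "t = r \<cdot> k"
      using dist_exact_contra_shift[OF tK t] by blast
    then show "t = \<zero>\<zero> K S"
      using T2_F2_zero[OF _ S r(1)] WX Comp_Zero_left[OF HK(1) WS(2)] by simp
  qed
  moreover have "K \<in> F1"
    using fibre_F1[OF tK] WX Y by blast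
  ultimately show thesis
    using that tK WX Y by blast
qed

section \<open>Push-outs of kernels and pull-backs of cokernels\<close>

text \<open>
  The extension \<open>P\<^sub>0\<close> of \<open>C\<close> by \<open>X'\<close> need not be compared with the given push-out any further: as
  \<open>f'\<close> followed by some morphism is the kernel \<open>f\<^sub>0\<close>, the cone of \<open>f'\<close> already lies in \<open>F1\<close>.
\<close>

lemma heart_pushout_kernel:
  assumes po: "is_pushout HC f g f' g'" and ker: "is_kernel HC f"
  shows "is_kernel HC f'"
proof -
  obtain X Y X' P where sq: "f \<in> Hom HC X Y" "g \<in> Hom HC X X'" "f' \<in> Hom HC X' P"
    and po': "\<forall>Q \<in> Obj HC. \<forall>a \<in> Hom HC X' Q. \<forall>b \<in> Hom HC Y Q. Comp HC a g = Comp HC b f \<longrightarrow>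
      (\<exists>!u. u \<in> Hom HC P Q \<and> Comp HC u f' = a \<and> Comp HC u g' = b)"
    using po unfolding is_pushout_def by blast
  have f: "f \<in> Hom D X Y" and g: "g \<in> Hom D X X'" and f': "f' \<in> Hom D X' P"
    and HH: "X' \<in> \<H>" "P \<in> \<H>" and Y: "Y \<in> \<H>"
    using sq by (simp_all add: Hom_full_subcategory split: if_splits)
  have univ: "\<exists>u. u \<in> Hom D P Q \<and> u \<cdot> f' = a"
    if "Q \<in> \<H>" "Q \<in> Obj D" "a \<in> Hom D X' Q" "b \<in> Hom D Y Q" "a \<cdot> g = b \<cdot> f" for Q a b
    using po'[rule_format, of Q a b] that HH Y
    by (simp add: Hom_full_subcategory full_subcategory_simps) blast
  obtain C c w where tC: "dist_triangle D X Y C f c w" and C: "C \<in> \<H>" "Y \<in> \<H>"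
    using triangle_of_kernel[OF ker f] by metis
  note HC = dist_triangle_Hom[OF tC] and OC = dist_triangle_Obj[OF tC]
  have OX': "X' \<in> Obj D"
    using Hom_Obj f' by blast
  have gw: "ShA D g \<cdot> w \<in> Hom D C (ShO D X')"
    by (rule Comp_Hom[OF HC(3) ShA_Hom[OF g]])
  \<comment> \<open>The triangle of f is changed along g: C is kept and the connecting morphism is
    transported by \<Sigma>g.\<close>
  obtain P0 f0 c0 where t0: "dist_triangle D X' P0 C f0 c0 (ShA D g \<cdot> w)"
    using extension_exists[OF gw OX'] by blast
  note H0 = dist_triangle_Hom[OF t0] and O0 = dist_triangle_Obj[OF t0]
  obtain b where b: "b \<in> Hom D Y P0" "b \<cdot> f = f0 \<cdot> g"
    using TR3_middle[OF tC t0 g Ident_Hom[OF OC(3)]] Comp_Ident_right[OF gw] by metis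
  have "P0 \<in> \<H>"
    by (rule heart_extension[OF t0 HH(1) C(1)])
  then obtain u where u: "u \<in> Hom D P P0" "u \<cdot> f' = f0"
    using univ[OF _ O0(2) H0(1) b(1)] b(2) by metis
  obtain A a a2 where tA: "dist_triangle D X' P A f' a a2"
    using TR1_cone f' by blast
  note HA = dist_triangle_Hom[OF tA] and OA = dist_triangle_Obj[OF tA]
  have sq: "u \<cdot> f' = f0 \<cdot> \<iota> X'"
    using u(2) Comp_Ident_right[OF H0(1)] by simp
  \<comment> \<open>The comparison with identity on X' expresses the connecting morphism of the cone
    A through C, so that C in F1 controls maps from T1 to A.\<close>
  obtain v where v: "v \<in> Hom D A C" "ShA D (\<iota> X') \<cdot> a2 = ShA D g \<cdot> w \<cdot> v"
    using TR3[OF tA t0 Ident_Hom[OF OX'] u(1) sq] by blast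
  have a2: "a2 = ShA D g \<cdot> w \<cdot> v"
    using v(2) ShA_Ident[OF OX'] Comp_Ident_left[OF HA(3)] by simp
  have "A \<in> F1"
  proof (rule F1I[OF OA(3)])
    fix S t assume S: "S \<in> T1" and t: "t \<in> Hom D S A"
    have "v \<cdot> t = \<zero>\<zero> S C"
      using T1_F1_zero[OF S _ Comp_Hom[OF t v(1)]] C by blast
    then have "a2 \<cdot> t = \<zero>\<zero> S (ShO D X')"
      using a2 Comp_assoc[OF t v(1) gw] Comp_Zero_right[OF gw Hom_Obj(1)[OF t]] by simp
    then obtain s where s: "s \<in> Hom D S P" "t = a \<cdot> s"
      using dist_exact_cov[OF rotate[OF tA] t] by blast
    then show "t = \<zero>\<zero> S A"
      using T1_F1_zero[OF S _ s(1)] HH Comp_Zero_right[OF HA(2) Hom_Obj(1)[OF t]] by simp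
  qed
  moreover have "A \<in> T2"
    using cone_T2[OF tA] HH by blast
  ultimately show ?thesis
    using kernel_cokernel_of_triangle(1)[OF tA HH] by blast
qed

text \<open>The comparison object is the extension of Y' by K with connecting morphism d g. It lies
  in the heart, so its map f0 to Y' factors through f', and this forces the fibre A of f' into
  T2.\<close>

lemma heart_pullback_cokernel:
  assumes pb: "is_pullback HC f g f' g'" and coker: "is_cokernel HC f"
  shows "is_cokernel HC f'"
proof -
  obtain X Y Y' P where sq: "f \<in> Hom HC X Y" "g \<in> Hom HC Y' Y" "f' \<in> Hom HC P Y'"
    and pb': "\<forall>Q \<in> Obj HC. \<forall>a \<in> Hom HC Q Y'. \<forall>b \<in> Hom HC Q X. Comp HC g a = Comp HC f b \<longrightarrow>
      (\<exists>!u. u \<in> Hom HC Q P \<and> Comp HC f' u = a \<and> Comp HC g' u = b)"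
    using pb unfolding is_pullback_def by blast
  have f: "f \<in> Hom D X Y" and g: "g \<in> Hom D Y' Y" and f': "f' \<in> Hom D P Y'"
    and HH: "P \<in> \<H>" "Y' \<in> \<H>" and X: "X \<in> \<H>"
    using sq by (simp_all add: Hom_full_subcategory split: if_splits)
  have univ: "\<exists>u. u \<in> Hom D Q P \<and> f' \<cdot> u = a"
    if "Q \<in> \<H>" "Q \<in> Obj D" "a \<in> Hom D Q Y'" "b \<in> Hom D Q X" "g \<cdot> a = f \<cdot> b" for Q a b
    using pb'[rule_format, of Q a b] that HH X
    by (simp add: Hom_full_subcategory full_subcategory_simps) blast
  obtain K k d where tK: "dist_triangle D K X Y k f d" and K: "K \<in> \<H>" "X \<in> \<H>"
    using triangle_of_cokernel[OF coker f] by metis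
  note HK = dist_triangle_Hom[OF tK] and OK = dist_triangle_Obj[OF tK]
  have OY': "Y' \<in> Obj D"
    using Hom_Obj f' by blast
  have dg: "d \<cdot> g \<in> Hom D Y' (ShO D K)"
    by (rule Comp_Hom[OF g HK(3)])
  obtain P0 k0 f0 where t0: "dist_triangle D K P0 Y' k0 f0 (d \<cdot> g)"
    using extension_exists[OF dg OK(1)] by blast
  note H0 = dist_triangle_Hom[OF t0] and O0 = dist_triangle_Obj[OF t0]
  have sq0: "ShA D (\<iota> K) \<cdot> (d \<cdot> g) = d \<cdot> g"
    using ShA_Ident[OF OK(1)] Comp_Ident_left[OF dg] by simp
  obtain b where b: "b \<in> Hom D P0 X" "g \<cdot> f0 = f \<cdot> b"
    using TR3_middle[OF t0 tK Ident_Hom[OF OK(1)] g sq0] by blast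
  have "P0 \<in> \<H>"
    by (rule heart_extension[OF t0 K(1) HH(2)])
  then obtain u where u: "u \<in> Hom D P0 P" "f' \<cdot> u = f0"
    using univ[OF _ O0(2) H0(2) b(1)] b(2) by metis
  obtain A a a2 where tA: "dist_triangle D A P Y' a f' a2"
    using fibre_exists f' by blast
  note HA = dist_triangle_Hom[OF tA] and OA = dist_triangle_Obj[OF tA]
  have sq: "\<iota> Y' \<cdot> f0 = f' \<cdot> u"
    using u(2) Comp_Ident_left[OF H0(2)] by simp
  obtain v where v: "v \<in> Hom D K A" "ShA D v \<cdot> (d \<cdot> g) = a2 \<cdot> \<iota> Y'"
    using TR3_left[OF t0 tA u(1) Ident_Hom[OF OY'] sq] by blast
  have a2: "a2 = ShA D v \<cdot> (d \<cdot> g)"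
    using v(2) Comp_Ident_right[OF HA(3)] by simp
  have "A \<in> T2"
  proof (rule T2I[OF OA(1)])
    fix S t assume S: "S \<in> F2" and t: "t \<in> Hom D A S"
    have OS: "S \<in> Obj D"
      using Hom_Obj t by blast
    \<comment> \<open>The connecting morphism of A passes through \<Sigma>v, so once t v vanishes t
      extends to P, which lies in T2.\<close>
    have "t \<cdot> v = \<zero>\<zero> K S"
      using T2_F2_zero[OF _ S Comp_Hom[OF v(1) t]] K by blast
    then have "ShA D t \<cdot> ShA D v = \<zero>\<zero> (ShO D K) (ShO D S)"
      using ShA_Comp[OF v(1) t] ShA_Zero[OF OK(1) OS] by simp
    then have "ShA D t \<cdot> a2 = \<zero>\<zero> Y' (ShO D S)"
      using a2 Comp_assoc[OF dg ShA_Hom[OF v(1)] ShA_Hom[OF t]] Comp_Zero_left[OF dg ShO_Obj[OF OS]]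
      by simp
    then obtain s where s: "s \<in> Hom D P S" "t = s \<cdot> a"
      using dist_exact_contra_shift[OF tA t] by blast
    then show "t = \<zero>\<zero> A S"
      using T2_F2_zero[OF _ S s(1)] HH Comp_Zero_left[OF HA(1) OS] by simp
  qed
  moreover have "A \<in> F1"
    using fibre_F1[OF tA] HH by blast
  ultimately show ?thesis
    using kernel_cokernel_of_triangle(2)[OF tA _ HH] by blast
qed

section \<open>Additivity of the heart and conclusion\<close>

lemma heart_additive: "additive_category HC"
proof (rule full_subcategory_additive)
  show "Z \<in> \<H>" if Z: "is_zero_object D Z" for Z
  proof
    have OZ: "Z \<in> Obj D"
      using Z by (simp add: is_zero_object_def)
    have zero: "f = \<zero>\<zero> X Z" if "f \<in> Hom D X Z" for f X
      using Z that Zero_Hom[OF _ OZ] Hom_Obj(1)[OF that] unfolding is_zero_object_def by blast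
    have zero': "f = \<zero>\<zero> Z X" if "f \<in> Hom D Z X" for f X
      using Z that Zero_Hom[OF OZ] Hom_Obj(2)[OF that] unfolding is_zero_object_def by blast
    show "Z \<in> F1"
      using F1I[OF OZ] zero by blast
    show "Z \<in> T2"
      using T2I[OF OZ] zero' by blast
  qed
  show "P \<in> \<H>"
    if XY: "X \<in> \<H>" "Y \<in> \<H>" and i: "i \<in> Hom D X P" and j: "j \<in> Hom D Y P" and p: "p \<in> Hom D P X"
      and q: "q \<in> Hom D P Y" and id: "(i \<cdot> p) \<boxplus> (j \<cdot> q) = \<iota> P"
    for X Y P i j p q
  proof
    have OP: "P \<in> Obj D"
      using Hom_Obj i by blast
    note ip = Comp_Hom[OF p i] and jq = Comp_Hom[OF q j]
    show "P \<in> F1"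
    proof (rule F1I[OF OP])
      fix S t assume S: "S \<in> T1" and t: "t \<in> Hom D S P"
      have OS: "S \<in> Obj D"
        using Hom_Obj t by blast
      have "p \<cdot> t = \<zero>\<zero> S X" "q \<cdot> t = \<zero>\<zero> S Y"
        using T1_F1_zero[OF S _ Comp_Hom[OF t p]] T1_F1_zero[OF S _ Comp_Hom[OF t q]] XY by blast+
      then have "i \<cdot> p \<cdot> t = \<zero>\<zero> S P" "j \<cdot> q \<cdot> t = \<zero>\<zero> S P"
        using Comp_assoc[OF t p i] Comp_assoc[OF t q j] Comp_Zero_right[OF i OS]
          Comp_Zero_right[OF j OS] by simp_all
      then show "t = \<zero>\<zero> S P"
        using Comp_Add_left[OF t ip jq] id Comp_Ident_left[OF t] Add_Zero[OF Zero_Hom[OF OS OP]] by simp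
    qed
    show "P \<in> T2"
    proof (rule T2I[OF OP])
      fix S t assume S: "S \<in> F2" and t: "t \<in> Hom D P S"
      have OS: "S \<in> Obj D"
        using Hom_Obj t by blast
      have "t \<cdot> i = \<zero>\<zero> X S" "t \<cdot> j = \<zero>\<zero> Y S"
        using T2_F2_zero[OF _ S Comp_Hom[OF i t]] T2_F2_zero[OF _ S Comp_Hom[OF j t]] XY by blast+
      then have "t \<cdot> (i \<cdot> p) = \<zero>\<zero> P S" "t \<cdot> (j \<cdot> q) = \<zero>\<zero> P S"
        using Comp_assoc[OF p i t] Comp_assoc[OF q j t] Comp_Zero_left[OF p OS]
          Comp_Zero_left[OF q OS] by simp_all
      then show "t = \<zero>\<zero> P S"
        using Comp_Add_right[OF ip jq t] id Comp_Ident_right[OF t] Add_Zero[OF Zero_Hom[OF OP OS]] by simp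
    qed
  qed
qed

theorem heart_quasi_abelian: "quasi_abelian_category HC"
proof (intro quasi_abelian_category.intro quasi_abelian_category_axioms.intro heart_additive)
  show "\<exists>k. is_kernel_of HC k f" if "f \<in> Arr HC" for f
    using heart_kernel[OF Arr_heartD[OF that]] by metis
  show "\<exists>c. is_cokernel_of HC c f" if "f \<in> Arr HC" for f
    using heart_cokernel[OF Arr_heartD[OF that]] by metis
qed (fact heart_pushout_kernel heart_pullback_cokernel)+

end

theorem theorem3p14:
  fixes D :: "('o, 'm) triangulated_data"
    and t1 t2 :: "'o set \<times> 'o set"
  assumes "triangulated_category D"
    and "normal_interval D t1 t2"
  shows "quasi_abelian_category (heart D t1 t2)"
proof -
  have "normal_torsion_interval D (fst t1) (snd t1) (fst t2) (snd t2)"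
    using assms by (auto simp: normal_torsion_interval_def normal_torsion_interval_axioms_def
        normal_interval_def is_interval_def stors_def)
  then show ?thesis
    unfolding heart_def by (rule normal_torsion_interval.heart_quasi_abelian)
qed

end
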